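(* For any integer $z\ge 0$ there is a PL embedding $f:K_6\to\mathbb{R}^3$ such that (1) the image of any 3-cycle of $K_6$ is unknotted; (2) for any pair of disjoint 3-cycles in $K_6$, except one (unordered) pair, the linking number of their images is zero; (3) for the exceptional pair of disjoint 3-cycles the absolute value of the linking number of their images is $2z+1$.
   Context: $K_6$ is the complete graph on 6 vertices, regarded as a 1-dimensional simplicial complex (topological space). PL means piecewise linear. The linking number is the usual integer linking number of disjoint oriented closed polygonal lines in $\mathbb{R}^3$; for non-oriented ones its absolute value $|\mathrm{lk}|$ is well defined. *)

theory Defs
  imports "HOL-Analysis.Analysis"
begin

definition piecewise_linear_on :: "'a::euclidean_space set \<Rightarrow> ('a \<Rightarrow> 'b::real_vector) \<Rightarrow> bool" where
  "piecewise_linear_on S f \<longleftrightarrow>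
     (\<exists>\<T>. triangulation \<T> \<and> \<Union>\<T> = S \<and>
          (\<forall>T\<in>\<T>. \<exists>h c. linear h \<and> (\<forall>x\<in>T. f x = h x + c)))"

(* The complete graph on 6 vertices is realized as the 1-skeleton of the standard 5-simplex in R^6. *)

definition K6_edge :: "6 \<Rightarrow> 6 \<Rightarrow> (real^6) set" where
  "K6_edge i j = closed_segment (axis i 1) (axis j 1)"

definition K6 :: "(real^6) set" where
  "K6 = (\<Union>i. \<Union>j. K6_edge i j)"

definition K6_three_cycles :: "(real^6) set set" where
  "K6_three_cycles =
     {K6_edge a b \<union> K6_edge b c \<union> K6_edge c a | a b c. a \<noteq> b \<and> b \<noteq> c \<and> c \<noteq> a}"

definition PL_embedding_K6 :: "(real^6 \<Rightarrow> real^3) \<Rightarrow> bool" where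
  "PL_embedding_K6 f \<longleftrightarrow>
     piecewise_linear_on K6 f \<and> embedding_map (top_of_set K6) euclidean f"

definition ambient_isotopic :: "'a::topological_space set \<Rightarrow> 'a set \<Rightarrow> bool" where
  "ambient_isotopic S T \<longleftrightarrow>
     (\<exists>H :: real \<times> 'a \<Rightarrow> 'a.
        continuous_on ({0..1} \<times> UNIV) H \<and>
        (\<forall>t\<in>{0..1}. homeomorphic_map euclidean euclidean (\<lambda>x. H (t, x))) \<and>
        (\<forall>x. H (0, x) = x) \<and>
        (\<lambda>x. H (1, x)) ` S = T)"

(* The model unknot is the outline of a nondegenerate triangle; all of these are ambient isotopic
   to each other and to a round circle. *)

definition unknotted :: "(real^3) set \<Rightarrow> bool" where
  "unknotted S \<longleftrightarrow>
     (\<exists>a b c. \<not> collinear {a, b, c} \<and>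
        ambient_isotopic S (closed_segment a b \<union> closed_segment b c \<union> closed_segment c a))"

definition closed_polygonal_line :: "(real \<Rightarrow> real^3) \<Rightarrow> bool" where
  "closed_polygonal_line p \<longleftrightarrow>
     simple_path p \<and> pathfinish p = pathstart p \<and> piecewise_linear_on {0..1} p"

(* The crossings of the diagram of p and q obtained by projecting along v. *)

definition crossings :: "real^3 \<Rightarrow> (real \<Rightarrow> real^3) \<Rightarrow> (real \<Rightarrow> real^3) \<Rightarrow> (real \<times> real) set" where
  "crossings v p q = {(s, t). s \<in> {0..1} \<and> t \<in> {0..1} \<and> (\<exists>c. p s - q t = c *\<^sub>R v)}"

definition generic_direction :: "real^3 \<Rightarrow> (real \<Rightarrow> real^3) \<Rightarrow> (real \<Rightarrow> real^3) \<Rightarrow> bool" where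
  "generic_direction v p q \<longleftrightarrow>
     v \<noteq> 0 \<and> finite (crossings v p q) \<and>
     (\<forall>(s, t)\<in>crossings v p q.
        s \<in> {0<..<1} \<and> t \<in> {0<..<1} \<and>
        p differentiable (at s) \<and> q differentiable (at t) \<and>
        det (vector [vector_derivative p (at s), vector_derivative q (at t), v] :: real^3^3) \<noteq> 0)"

(* If p passes over q at the crossing, then p s - q t points towards the viewer and the
   determinant is positive iff the crossing is right-handed. If q passes over p, interchanging
   the strands also reverses the third vector, so the same formula gives the sign. *)

definition crossing_sign :: "(real \<Rightarrow> real^3) \<Rightarrow> (real \<Rightarrow> real^3) \<Rightarrow> real \<times> real \<Rightarrow> real" where
  "crossing_sign p q = (\<lambda>(s, t).
     sgn (det (vector [vector_derivative p (at s), vector_derivative q (at t), p s - q t] :: real^3^3)))"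

(* Half the sum of the signs of the crossings between p and q in a generic projection. A generic
   direction exists and the sum does not depend on it, so the existential quantifier
   determines n uniquely. *)

definition has_linking_number :: "(real \<Rightarrow> real^3) \<Rightarrow> (real \<Rightarrow> real^3) \<Rightarrow> int \<Rightarrow> bool" where
  "has_linking_number p q n \<longleftrightarrow>
     closed_polygonal_line p \<and> closed_polygonal_line q \<and>
     path_image p \<inter> path_image q = {} \<and>
     (\<exists>v. generic_direction v p q \<and>
          2 * real_of_int n = (\<Sum>x\<in>crossings v p q. crossing_sign p q x))"

(* The absolute linking number of non-oriented closed polygonal lines, given as point sets. Two
   parametrizations of the same line differ by the base point, the speed and the orientation,
   so the absolute value of the linking number does not depend on the choice of p and q. *)

definition has_abs_linking_number :: "(real^3) set \<Rightarrow> (real^3) set \<Rightarrow> int \<Rightarrow> bool" where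
  "has_abs_linking_number S T m \<longleftrightarrow>
     (\<exists>p q n. path_image p = S \<and> path_image q = T \<and> has_linking_number p q n \<and> m = \<bar>n\<bar>)"

end

theory Submission
  imports Defs
begin

text \<open>Place the six vertices at different heights and draw every edge as a graph over its height
  interval. Every 3-cycle is then a union of two graphs over the same interval, hence unknotted, however the
  edges wind around each other. Start from such a drawing in which a single pair of disjoint
  triangles is linked, with linking number one, and let three pairs of disjoint edges make \<open>z\<close> full
  turns around each other at middle heights. The linking numbers are sums of crossing
  signs over the slabs between consecutive integer heights, and they are affine functions of \<open>z\<close>.\<close>

text \<open>A 3-cycle has a lowest, a middle and a highest vertex: the edge between the extremes is
  one of its two graphs, and the two edges through the middle vertex form the other. Twisting
  therefore never knots a 3-cycle, and only the linking numbers need control. A full turn of two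
  disjoint edges changes exactly two of them, each by one, according to how the two remaining
  vertices are distributed. One twisted pair of edges can thus not isolate a pair of triangles, but
  a closed cycle of three can. That the exceptional value is odd reflects the theorem of
  Conway-Gordon and Sachs: the ten linking numbers have odd sum. The obstacle is to turn claims
  about all real heights and all \<open>z\<close> into a finite check. At integer heights, edges
  have different real parts except at a shared vertex. Seen along the imaginary axis, crossings of
  disjoint edges then lie strictly inside slabs, where strands are affine, and over or under is the
  sign of a 2 by 2 determinant of integers. The turns repeat the same three stages, so nine stages
  and nine steps between them cover every \<open>z\<close>.\<close>

definition pt :: "real \<Rightarrow> complex \<Rightarrow> real^3" where
  "pt h w = vector [h, Re w, Im w]"

lemma pt_nth [simp]: "pt h w $ 1 = h" "pt h w $ 2 = Re w" "pt h w $ 3 = Im w"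
  by (simp_all add: pt_def)

lemma vec3_eq_iff: "x = y \<longleftrightarrow> x$1 = y$1 \<and> x$2 = y$2 \<and> x$3 = y$3" for x y :: "'a^3"
  by (metis (mono_tags) exhaust_3 vec_eq_iff)

lemma pt_eq_iff [simp]: "pt h w = pt h' w' \<longleftrightarrow> h = h' \<and> w = w'"
  by (auto simp: vec3_eq_iff complex_eq_iff)

definition planar :: "real^3 \<Rightarrow> complex" where
  "planar x = Complex (x$2) (x$3)"

lemma planar_pt [simp]: "planar (pt h w) = w" and pt_planar [simp]: "pt (x$1) (planar x) = x"
  by (simp_all add: vec3_eq_iff planar_def)

lemma continuous_on_planar [continuous_intros]:
  "continuous_on S f \<Longrightarrow> continuous_on S (\<lambda>x. planar (f x))"
  unfolding planar_def Complex_eq by (intro continuous_intros)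

lemma pt_add: "pt h w + pt h' w' = pt (h + h') (w + w')"
  and pt_diff: "pt h w - pt h' w' = pt (h - h') (w - w')"
  and pt_scaleR: "c *\<^sub>R pt h w = pt (c * h) (c *\<^sub>R w)"
  by (simp_all add: vec3_eq_iff)

lemma continuous_on_pt [continuous_intros]:
  assumes "continuous_on S f" "continuous_on S g"
  shows "continuous_on S (\<lambda>x. pt (f x) (g x))"
proof -
  have "continuous_on S (\<lambda>x. Re (g x))" "continuous_on S (\<lambda>x. Im (g x))"
    using assms by (auto intro!: continuous_intros)
  then have "continuous_on S (\<lambda>x. pt (f x) (g x) $ i)" for i
    using exhaust_3[of i] assms(1) by (elim disjE) simp_all
  then show ?thesis
    using continuous_on_vec_lambda[of S "\<lambda>i x. pt (f x) (g x) $ i"] by simp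
qed

section \<open>Polygonal graphs over the height axis with breakpoints at integer heights\<close>

definition ramp :: "real \<Rightarrow> real" where
  "ramp x = max 0 (min 1 x)"

text \<open>A sum of ramps instead of a case distinction by slabs: continuity on the whole line and
  linearity in \<open>w\<close> are then immediate. Outside \<open>[0, N]\<close> the value is
  constant.\<close>

definition polyline :: "nat \<Rightarrow> (nat \<Rightarrow> complex) \<Rightarrow> real \<Rightarrow> complex" where
  "polyline N w h = w 0 + (\<Sum>k<N. ramp (h - real k) *\<^sub>R (w (Suc k) - w k))"

lemma continuous_on_polyline: "continuous_on S (polyline N w)"
  unfolding polyline_def ramp_def by (intro continuous_intros)

lemma continuous_on_polyline' [continuous_intros]:
  "continuous_on S g \<Longrightarrow> continuous_on S (\<lambda>x. polyline N w (g x))"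
  by (rule continuous_on_compose2[OF continuous_on_polyline[of UNIV]]) auto

text \<open>Ramps starting below \<open>n\<close> have saturated at 1 and telescope to
  \<open>w n - w 0\<close>; ramps starting above \<open>n\<close> are still 0.\<close>

lemma polyline_slab:
  assumes "n < N" "real n \<le> h" "h \<le> real n + 1"
  shows "polyline N w h = w n + (h - real n) *\<^sub>R (w (Suc n) - w n)"
proof -
  have "{..<N} = {..<n} \<union> {n} \<union> {Suc n..<N}" "{..<n} \<inter> {Suc n..<N} = {}"
    using assms by auto
  then have "(\<Sum>k<N. ramp (h - real k) *\<^sub>R (w (Suc k) - w k)) =
      (\<Sum>k<n. ramp (h - real k) *\<^sub>R (w (Suc k) - w k)) +
      (ramp (h - real n) *\<^sub>R (w (Suc n) - w n) +
       (\<Sum>k\<in>{Suc n..<N}. ramp (h - real k) *\<^sub>R (w (Suc k) - w k)))"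
    by (simp add: sum.union_disjoint algebra_simps)
  also have "(\<Sum>k<n. ramp (h - real k) *\<^sub>R (w (Suc k) - w k)) = (\<Sum>k<n. w (Suc k) - w k)"
    using assms by (intro sum.cong) (auto simp: ramp_def)
  also have "\<dots> = w n - w 0"
    by (rule sum_lessThan_telescope)
  also have "(\<Sum>k\<in>{Suc n..<N}. ramp (h - real k) *\<^sub>R (w (Suc k) - w k)) = 0"
    using assms by (intro sum.neutral) (auto simp: ramp_def)
  also have "ramp (h - real n) = h - real n"
    using assms by (auto simp: ramp_def)
  finally show ?thesis
    by (simp add: polyline_def)
qed

lemma polyline_of_nat [simp]:
  assumes "n \<le> N"
  shows "polyline N w (real n) = w n"
proof (cases n)
  case 0
  then show ?thesis
    by (auto simp: polyline_def ramp_def)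
next
  case (Suc m)
  then show ?thesis
    using assms polyline_slab[of m N "real n" w] by simp
qed

lemma polyline_diff: "polyline N w h - polyline N v h = polyline N (\<lambda>n. w n - v n) h"
  by (simp add: polyline_def sum_subtractf scaleR_diff_right)

lemma slab_cases:
  fixes h :: real
  assumes "real a \<le> h" "h \<le> real b" "a < b"
  obtains n where "a \<le> n" "n < b" "real n \<le> h" "h \<le> real n + 1"
\<comment> \<open>The floor of \<open>h\<close> fails only at the top, which belongs to the slab
  below it.\<close>
proof (cases "h = real b")
  case True
  then show ?thesis
    using assms that[of "b - 1"] by (auto simp: of_nat_diff)
next
  case False
  let ?n = "nat \<lfloor>h\<rfloor>"
  have "0 \<le> h"
    using assms(1) of_nat_0_le_iff order_trans by blast
  then have "real ?n = of_int \<lfloor>h\<rfloor>"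
    by simp
  then have *: "real ?n \<le> h" "h < real ?n + 1"
    by linarith+
  then have "a \<le> ?n" "?n < b"
    using assms False by linarith+
  then show ?thesis
    using * that by force
qed

lemma polyline_cong:
  assumes "\<And>n. a \<le> n \<Longrightarrow> n \<le> b \<Longrightarrow> w n = v n" "real a \<le> h" "h \<le> real b" "a < b" "b \<le> N"
  shows "polyline N w h = polyline N v h"
proof -
  obtain n where "a \<le> n" "n < b" "real n \<le> h" "h \<le> real n + 1"
    using slab_cases assms by metis
  then show ?thesis
    using assms by (simp add: polyline_slab[of n])
qed

section \<open>Closed curves with one minimum and one maximum of the height\<close>

definition strand :: "nat \<Rightarrow> (nat \<Rightarrow> complex) \<Rightarrow> nat \<Rightarrow> nat \<Rightarrow> (real^3) set" where
  "strand N w a b = (\<lambda>h. pt h (polyline N w h)) ` {real a..real b}"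

text \<open>The isotopy preserves heights and moves each horizontal plane by a complex affine map.\<close>

lemma ambient_isotopic_fibrewise:
  fixes \<alpha> g :: "real \<Rightarrow> complex"
  assumes "continuous_on UNIV \<alpha>" "continuous_on UNIV g"
  shows "ambient_isotopic S
    ((\<lambda>x. pt (x$1) ((planar x - \<alpha> (x$1)) * exp (- g (x$1)))) ` S)"
proof -
  \<comment> \<open>Scaling \<open>\<alpha>\<close> and \<open>g\<close> by \<open>t\<close> gives
    the identity at time 0. The factor is an exponential so that it stays nonzero at all times, and
    \<open>G\<close> can undo \<open>H\<close> at each \<open>t\<close>.\<close>
  define H where "H = (\<lambda>(t::real, x::real^3).
      pt (x$1) ((planar x - complex_of_real t * \<alpha> (x$1)) * exp (- (complex_of_real t * g (x$1)))))"
  define G where "G = (\<lambda>(t::real, x::real^3).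
      pt (x$1) (planar x * exp (complex_of_real t * g (x$1)) + complex_of_real t * \<alpha> (x$1)))"
  have c\<alpha>: "continuous_on X (\<lambda>x. \<alpha> (u x))" if "continuous_on X u" for X :: "'b::topological_space set" and u
    using that by (rule continuous_on_compose2[OF assms(1)]) auto
  have cg: "continuous_on X (\<lambda>x. g (u x))" if "continuous_on X u" for X :: "'b::topological_space set" and u
    using that by (rule continuous_on_compose2[OF assms(2)]) auto
  have cont: "continuous_on X H" "continuous_on X G" for X
    unfolding H_def G_def split_def by (intro continuous_intros c\<alpha> cg)+
  have homeo: "homeomorphic_map euclidean euclidean (\<lambda>x. H (t, x))" for t
  proof -
    have "continuous_on UNIV (\<lambda>x. H (t, x))" "continuous_on UNIV (\<lambda>x. G (t, x))"
      by (rule continuous_on_compose2[OF cont(1)[of UNIV]] continuous_on_compose2[OF cont(2)[of UNIV]];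
          intro continuous_intros subset_UNIV)+
    moreover have "G (t, H (t, x)) = x" "H (t, G (t, x)) = x" for x
      by (simp_all add: G_def H_def exp_minus mult.assoc)
    ultimately show ?thesis
      unfolding homeomorphic_map_maps homeomorphic_maps_def
      by (intro exI[of _ "\<lambda>x. G (t, x)"]) simp
  qed
  show ?thesis
    unfolding ambient_isotopic_def
    by (rule exI[of _ H]) (use homeo cont in \<open>auto simp: H_def\<close>)
qed


lemma closed_segment_pt:
  assumes "h < h'"
  shows "closed_segment (pt h w) (pt h' w') =
    (\<lambda>x. pt x (w + ((x - h) / (h' - h)) *\<^sub>R (w' - w))) ` {h..h'}" (is "?L = ?R")
proof
  show "?L \<subseteq> ?R"
  proof
    fix x assume "x \<in> ?L"
    then obtain u where u: "0 \<le> u" "u \<le> 1" "x = (1 - u) *\<^sub>R pt h w + u *\<^sub>R pt h' w'"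
      by (auto simp: in_segment)
    have "0 \<le> u * (h' - h)" "u * (h' - h) \<le> h' - h"
      using u assms by (auto intro: mult_left_le_one_le)
    then have "h + u * (h' - h) \<in> {h..h'}"
      by auto
    moreover have "x = pt (h + u * (h' - h)) (w + ((h + u * (h' - h) - h) / (h' - h)) *\<^sub>R (w' - w))"
    proof -
      have "(h + u * (h' - h) - h) / (h' - h) = u"
        using assms by simp
      then show ?thesis
        by (simp only: u(3) pt_add pt_scaleR) (simp add: algebra_simps)
    qed
    ultimately show "x \<in> ?R"
      by blast
  qed
  show "?R \<subseteq> ?L"
  proof clarify
    fix x assume x: "x \<in> {h..h'}"
    define u where "u = (x - h) / (h' - h)"
    have "0 \<le> u" "u \<le> 1" and xu: "x = h + u * (h' - h)"
      using x assms by (auto simp: u_def divide_simps)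
    moreover have "pt x (w + u *\<^sub>R (w' - w)) = (1 - u) *\<^sub>R pt h w + u *\<^sub>R pt h' w'"
      by (simp add: pt_add pt_scaleR xu algebra_simps)
    ultimately show "pt x (w + ((x - h) / (h' - h)) *\<^sub>R (w' - w)) \<in> ?L"
      unfolding in_segment u_def by blast
  qed
qed

text \<open>The difference of the two strands is the tent function over \<^term>\<open>{a..b}\<close> times a
  nowhere vanishing continuous function, because near its ends it is linear in the height. Dividing by
  the exponential of a logarithm of that factor straightens the curve to a triangle.\<close>

lemma unknotted_strands:
  assumes ab: "a + 2 \<le> b" "b \<le> N" and ends: "\<alpha> a = \<beta> a" "\<alpha> b = \<beta> b"
    and disj: "\<And>h. real a < h \<Longrightarrow> h < real b \<Longrightarrow> polyline N \<alpha> h \<noteq> polyline N \<beta> h"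
  shows "unknotted (strand N \<alpha> a b \<union> strand N \<beta> a b)"
proof -
  define w where "w = (\<lambda>n. \<beta> n - \<alpha> n)"
  define tent where "tent = (\<lambda>h. min (h - real a) (real b - h))"
  \<comment> \<open>Clamping to \<open>[a + 1, b - 1]\<close>, nonempty because
    \<open>a + 2 <= b\<close>, keeps the tent positive, so \<open>q\<close> is continuous on the
    whole line. In the two outer slabs both the difference and the tent are linear and vanish at the
    end, so their quotient is constant there and the clamp does not change it.\<close>
  define c where "c = (\<lambda>h. max (real a + 1) (min (real b - 1) h))"
  define q where "q = (\<lambda>h. polyline N w (c h) / complex_of_real (tent (c h)))"
  have ab': "real a + 2 \<le> real b"
    using ab by linarith
  have c: "real a < c h" "c h < real b" for h
    using ab' by (auto simp: c_def)
  then have tc: "tent (c h) > 0" for h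
    by (auto simp: tent_def)
  have lw: "polyline N w h = polyline N \<beta> h - polyline N \<alpha> h" for h
    by (simp add: w_def polyline_diff)
  have q_cont: "continuous_on UNIV q"
    unfolding q_def using tc less_imp_neq[OF tc]
    by (intro continuous_intros) (auto simp: c_def tent_def intro!: continuous_intros)
  have q_nz: "q h \<noteq> 0" for h
  proof -
    have "polyline N w (c h) \<noteq> 0"
      unfolding lw using disj[OF c[of h]] by (metis eq_iff_diff_eq_0)
    then show ?thesis
      using tc[of h] by (simp add: q_def)
  qed
  \<comment> \<open>The line is contractible, so a nowhere vanishing function on it has a continuous
    logarithm: the winding of the strands around each other is unwound here.\<close>
  obtain g where g: "continuous_on UNIV g" "\<And>h. q h = exp (g h)"
    using continuous_logarithm_on_contractible[OF q_cont] q_nz convex_imp_contractible[OF convex_UNIV]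
    by (metis UNIV_I)
  have diff: "polyline N w h = complex_of_real (tent h) * exp (g h)" if h: "real a \<le> h" "h \<le> real b" for h
  proof -
    have "polyline N w h = complex_of_real (tent h) * q h"
    proof (cases "h < real a + 1 \<or> h > real b - 1")
      case False
      then have "c h = h"
        by (auto simp: c_def)
      then show ?thesis
        using tc[of h] by (simp add: q_def)
    next
      case True
      then show ?thesis
      proof
        assume *: "h < real a + 1"
        have "c h = real (a + 1)" "tent (real (a + 1)) = 1" "tent h = h - a"
          using * h ab' by (auto simp: c_def tent_def)
        moreover have "polyline N w h = (h - a) *\<^sub>R w (Suc a)"
          using polyline_slab[of a N h w] * h ab ends by (simp add: w_def)
        moreover have "polyline N w (real (a + 1)) = w (Suc a)"
          using ab by (subst polyline_of_nat) auto
        ultimately show ?thesis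
          by (simp add: q_def scaleR_conv_of_real del: of_nat_add)
      next
        assume *: "h > real b - 1"
        have "c h = real (b - 1)" "tent (real (b - 1)) = 1" "tent h = b - h"
          using * h ab ab' by (auto simp: c_def tent_def of_nat_diff)
        moreover have "polyline N w h = (b - h) *\<^sub>R w (b - 1)"
          using polyline_slab[of "b - 1" N h w] * h ab ends
          by (simp add: w_def of_nat_diff algebra_simps)
        moreover have "polyline N w (real (b - 1)) = w (b - 1)"
          using ab by (subst polyline_of_nat) auto
        ultimately show ?thesis
          by (simp add: q_def scaleR_conv_of_real)
      qed
    qed
    then show ?thesis
      using g(2) by simp
  qed
  \<comment> \<open>The end of the isotopy. The first strand becomes the vertical segment
    \<open>A B\<close>, the second the graph of the tent, which consists of the sides
    \<open>A C\<close> and \<open>C B\<close> with apex at the middle height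
    \<open>m\<close>.\<close>
  define \<Phi> where "\<Phi> = (\<lambda>x. pt (x$1) ((planar x - polyline N \<alpha> (x$1)) * exp (- g (x$1))))"
  define m where "m = (real a + real b) / 2"
  define A where "A = pt a 0"
  define B where "B = pt b 0"
  define C where "C = pt m (complex_of_real (m - a))"
  have m: "a < m" "m < b"
    using ab' by (auto simp: m_def)
  have "\<Phi> ` strand N \<alpha> a b = (\<lambda>h. pt h 0) ` {real a..real b}"
    by (simp add: \<Phi>_def strand_def image_image)
  also have "\<dots> = closed_segment A B"
    unfolding A_def B_def using ab' by (subst closed_segment_pt) auto
  finally have 1: "\<Phi> ` strand N \<alpha> a b = closed_segment A B" .
  have "\<Phi> ` strand N \<beta> a b = (\<lambda>h. pt h (complex_of_real (tent h))) ` {real a..real b}"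
    unfolding \<Phi>_def strand_def image_image
    by (intro image_cong) (auto simp: lw[symmetric] diff exp_minus)
  also have "{real a..real b} = {a..m} \<union> {m..b}"
    using m by auto
  also note image_Un
  also have "(\<lambda>h. pt h (complex_of_real (tent h))) ` {a..m} = closed_segment A C"
    unfolding A_def C_def using m
    by (subst closed_segment_pt) (auto intro!: image_cong simp: tent_def m_def scaleR_conv_of_real)
  also have "(\<lambda>h. pt h (complex_of_real (tent h))) ` {m..b} = closed_segment C B"
    unfolding B_def C_def using m
    by (subst closed_segment_pt) (auto intro!: image_cong simp: tent_def m_def scaleR_conv_of_real field_simps)
  finally have 2: "\<Phi> ` strand N \<beta> a b = closed_segment A C \<union> closed_segment C B" .
  have "\<not> collinear {A, B, C}"
  proof
    assume "collinear {A, B, C}"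
    then obtain u where u: "\<forall>x\<in>{A,B,C}. \<forall>y\<in>{A,B,C}. \<exists>k. x - y = k *\<^sub>R u"
      unfolding collinear_def by blast
    then obtain k l where kl: "B - A = k *\<^sub>R u" "C - A = l *\<^sub>R u"
      by (metis insertCI)
    have "(B - A)$1 * (C - A)$2 = (C - A)$1 * (B - A)$2"
      unfolding kl by simp
    then show False
      using ab' by (simp add: A_def B_def C_def m_def)
  qed
  moreover have "ambient_isotopic (strand N \<alpha> a b \<union> strand N \<beta> a b)
      (closed_segment A B \<union> closed_segment B C \<union> closed_segment C A)"
    using ambient_isotopic_fibrewise[OF continuous_on_polyline[of UNIV N \<alpha>] g(1), of "strand N \<alpha> a b \<union> strand N \<beta> a b"]
    unfolding \<Phi>_def[symmetric] image_Un 1 2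
    by (simp add: Un_assoc closed_segment_commute) (simp add: Un_commute)
  ultimately show ?thesis
    unfolding unknotted_def by blast
qed

section \<open>Piecewise linear maps on segment complexes\<close>

text \<open>Two different segments of the family meet in at most one point, a common endpoint, and
  an endpoint is an extreme point, hence a face. The pairs are compared as sets because a segment
  may be listed in either direction.\<close>

lemma triangulation_segments:
  fixes E :: "('a::euclidean_space \<times> 'a) set"
  assumes fin: "finite E" and neq: "\<And>a b. (a, b) \<in> E \<Longrightarrow> a \<noteq> b"
    and int: "\<And>a b c d x. (a, b) \<in> E \<Longrightarrow> (c, d) \<in> E \<Longrightarrow> x \<in> closed_segment a b \<Longrightarrow>
      x \<in> closed_segment c d \<Longrightarrow> {a, b} = {c, d} \<or> x \<in> {a, b} \<inter> {c, d}"
  shows "triangulation ((\<lambda>(a, b). closed_segment a b) ` E \<union> (\<lambda>x. {x}) ` (fst ` E \<union> snd ` E))"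
    (is "triangulation (?S \<union> ?P)")
proof -
  have ss: "(closed_segment a b \<inter> closed_segment c d) face_of closed_segment a b"
    if ab: "(a, b) \<in> E" and cd: "(c, d) \<in> E" for a b c d
  proof (cases "{a, b} = {c, d}")
    case True
    then have "closed_segment c d = closed_segment a b"
      by (auto simp: doubleton_eq_iff closed_segment_commute)
    then show ?thesis
      by (metis convex_closed_segment face_of_refl inf.idem)
  next
    case False
    let ?I = "closed_segment a b \<inter> closed_segment c d"
    have sub: "?I \<subseteq> {a, b}"
      using int[OF ab cd] False by auto
    \<comment> \<open>If both endpoints were common, convexity would make the midpoint common too,
      against \<open>sub\<close>.\<close>
    have "\<not> {a, b} \<subseteq> ?I"
    proof
      assume "{a, b} \<subseteq> ?I"
      then have "closed_segment a b \<subseteq> ?I"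
        by (meson convex_Int convex_closed_segment convex_contains_segment insert_subset)
      then have "midpoint a b \<in> {a, b}"
        using sub midpoint_in_closed_segment by blast
      then show False
        using neq[OF ab] by (simp add: midpoint_eq_endpoint)
    qed
    then consider "?I = {}" | "?I = {a}" | "?I = {b}"
      using sub by blast
    then show ?thesis
      by cases (simp_all add: face_of_singleton extreme_point_of_segment)
  qed
  have sp: "(closed_segment a b \<inter> {x}) face_of closed_segment a b"
    if ab: "(a, b) \<in> E" and x: "x \<in> fst ` E \<union> snd ` E" for a b x
  proof (cases "x \<in> closed_segment a b")
    case True
    obtain c d where cd: "(c, d) \<in> E" "x \<in> {c, d}"
      using x by force
    then have "x \<in> closed_segment c d"
      by auto
    then have "x = a \<or> x = b"
      using int[OF ab cd(1) True] cd(2) by auto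
    then show ?thesis
      using True by (simp add: face_of_singleton extreme_point_of_segment)
  qed simp
  have ps: "({x} \<inter> T) face_of {x}" for x :: 'a and T
    by (cases "x \<in> T") (simp_all add: face_of_refl)
  show ?thesis
    unfolding triangulation_def
  proof (intro conjI ballI allI impI; (elim conjE)?)
    show "finite (?S \<union> ?P)"
      using fin by simp
  next
    fix T assume "T \<in> ?S \<union> ?P"
    then show "\<exists>n. n simplex T"
      using neq one_simplex_segment zero_simplex_sing by (elim UnE imageE) (auto, blast+)
  next
    fix T T' assume T: "T \<in> ?S \<union> ?P" and T': "T' \<in> ?S \<union> ?P"
    show "(T \<inter> T') face_of T"
    proof (cases "T \<in> ?P")
      case True
      then show ?thesis
        using ps by fast
    next
      case False
      then obtain a b where ab: "(a, b) \<in> E" "T = closed_segment a b"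
        using T by auto
      from T' consider (seg) c d where "(c, d) \<in> E" "T' = closed_segment c d"
        | (point) x where "x \<in> fst ` E \<union> snd ` E" "T' = {x}"
        by blast
      then show ?thesis
        by cases (use ab ss sp in \<open>simp_all only: ab\<close>)
    qed
  qed
qed

lemma piecewise_linear_on_segments:
  fixes f :: "'a::euclidean_space \<Rightarrow> 'b::real_vector"
  assumes "finite E" and "\<And>a b. (a, b) \<in> E \<Longrightarrow> a \<noteq> b"
    and "\<And>a b c d x. (a, b) \<in> E \<Longrightarrow> (c, d) \<in> E \<Longrightarrow> x \<in> closed_segment a b \<Longrightarrow>
      x \<in> closed_segment c d \<Longrightarrow> {a, b} = {c, d} \<or> x \<in> {a, b} \<inter> {c, d}"
    and S: "S = (\<Union>(a, b)\<in>E. closed_segment a b)"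
    and affine: "\<And>a b. (a, b) \<in> E \<Longrightarrow> \<exists>h c. linear h \<and> (\<forall>x\<in>closed_segment a b. f x = h x + c)"
  shows "piecewise_linear_on S f"
  unfolding piecewise_linear_on_def
proof (intro exI conjI)
  let ?T = "(\<lambda>(a, b). closed_segment a b) ` E \<union> (\<lambda>x. {x}) ` (fst ` E \<union> snd ` E)"
  show "triangulation ?T"
    by (rule triangulation_segments[OF assms(1-3)])
  show "\<Union>?T = S"
    unfolding S by force
  have "\<exists>h c. linear h \<and> (\<forall>y\<in>{x}. f y = h y + c)" for x
    by (intro exI[of _ "\<lambda>_. 0"] exI[of _ "f x"]) (simp add: linear_zero)
  then show "\<forall>T\<in>?T. \<exists>h c. linear h \<and> (\<forall>x\<in>T. f x = h x + c)"
    using affine by auto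
qed

text \<open>The breakpoints are \<open>k / m\<close>; the condition is multiplied by
  \<open>m\<close> so that pieces are found by comparison with integers.\<close>

lemma piecewise_linear_on_unit_interval:
  fixes p :: "real \<Rightarrow> 'b::real_vector"
  assumes "0 < m" and p: "\<And>k. k < m \<Longrightarrow> \<exists>D c. \<forall>s. real k \<le> real m * s \<longrightarrow> real m * s \<le> real k + 1 \<longrightarrow> p s = s *\<^sub>R D + c"
  shows "piecewise_linear_on {0..1} p"
proof (rule piecewise_linear_on_segments)
  define E where "E = (\<lambda>k. (real k / real m, real (Suc k) / real m)) ` {..<m}"
  show "finite E"
    by (simp add: E_def)
  have seg: "x \<in> closed_segment (real k / real m) (real (Suc k) / real m) \<longleftrightarrow>
      real k \<le> real m * x \<and> real m * x \<le> real k + 1" for k x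
    using assms(1) by (simp add: closed_segment_eq_real_ivl field_simps)
  show "a \<noteq> b" if "(a, b) \<in> E" for a b
    using that assms(1) by (auto simp: E_def)
  show "{a, b} = {c, d} \<or> x \<in> {a, b} \<inter> {c, d}"
    if ab: "(a, b) \<in> E" and cd: "(c, d) \<in> E" and x: "x \<in> closed_segment a b" "x \<in> closed_segment c d"
    for a b c d x
  proof -
    obtain k l where k: "a = real k / real m" "b = real (Suc k) / real m"
      and l: "c = real l / real m" "d = real (Suc l) / real m"
      using ab cd by (auto simp: E_def)
    have *: "real k \<le> real m * x" "real m * x \<le> real k + 1" "real l \<le> real m * x" "real m * x \<le> real l + 1"
      using x unfolding k l seg by auto
    then have "k = l \<or> (l = Suc k \<and> real m * x = real l) \<or> (k = Suc l \<and> real m * x = real k)"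
      by linarith
    then show ?thesis
      using assms(1) unfolding k l by (auto simp: field_simps)
  qed
  show "{0..1} = (\<Union>(a, b)\<in>E. closed_segment a b)"
  proof safe
    fix x :: real assume x: "x \<in> {0..1}"
    then have "real 0 \<le> real m * x" "real m * x \<le> real m"
      by (auto intro: mult_left_le)
    then obtain k where "k < m" "real k \<le> real m * x" "real m * x \<le> real k + 1"
      using slab_cases assms(1) by metis
    then show "x \<in> (\<Union>(a, b)\<in>E. closed_segment a b)"
      using seg by (auto simp: E_def simp del: of_nat_Suc)
  next
    fix x a b assume "(a, b) \<in> E" "x \<in> closed_segment a b"
    then obtain k where k: "k < m" "real k \<le> real m * x" "real m * x \<le> real k + 1"
      using seg by (auto simp: E_def simp del: of_nat_Suc)
    then have "0 \<le> real m * x" "real m * x \<le> real m * 1"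
      by linarith+
    then show "x \<in> {0..1}"
      using assms(1) by (simp add: zero_le_mult_iff)
  qed
  show "\<exists>h c. linear h \<and> (\<forall>x\<in>closed_segment a b. p x = h x + c)" if E: "(a, b) \<in> E" for a b
  proof -
    obtain k where k: "k < m" "a = real k / real m" "b = real (Suc k) / real m"
      using E by (auto simp: E_def simp del: of_nat_Suc)
    obtain D c where "\<forall>s. real k \<le> real m * s \<longrightarrow> real m * s \<le> real k + 1 \<longrightarrow> p s = s *\<^sub>R D + c"
      using p[OF k(1)] by blast
    then have "\<forall>x\<in>closed_segment a b. p x = x *\<^sub>R D + c"
      unfolding k using seg by blast
    moreover have "linear (\<lambda>x::real. x *\<^sub>R D)"
      by (intro linearI) (simp_all add: algebra_simps)
    ultimately show ?thesis
      by blast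
  qed
qed

section \<open>Parametrised bigons\<close>

text \<open>A bigon is traversed upwards along the strand \<^const>\<open>True\<close> and downwards along the
  strand \<^const>\<open>False\<close>; \<open>loop_time\<close> is the parameter at which a strand reaches a given height.\<close>

definition loop_time :: "nat \<Rightarrow> nat \<Rightarrow> bool \<Rightarrow> real \<Rightarrow> real" where
  "loop_time a b \<sigma> h =
     (let u = (h - real a) / (2 * (real b - real a)) in if \<sigma> then u else 1 - u)"

definition orient :: "bool \<Rightarrow> real" where
  "orient \<sigma> = of_bool \<sigma> - of_bool (\<not> \<sigma>)"

locale bigon =
  fixes N a b :: nat and st :: "bool \<Rightarrow> nat \<Rightarrow> complex"
  assumes ab: "a < b" "b \<le> N"
    and ends: "st True a = st False a" "st True b = st False b"
    and disj: "\<And>h. real a < h \<Longrightarrow> h < real b \<Longrightarrow> polyline N (st True) h \<noteq> polyline N (st False) h"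
begin

text \<open>A tent in \<open>s\<close> with its top at 1/2: each half of the unit interval sweeps
  all of \<open>[a, b]\<close>, and \<open>loop_time\<close> inverts the two halves.\<close>

definition height :: "real \<Rightarrow> real" where
  "height s = real a + 2 * (real b - real a) * min s (1 - s)"

definition loop :: "real \<Rightarrow> real^3" where
  "loop s = pt (height s) (if s \<le> 1/2 then polyline N (st True) (height s) else polyline N (st False) (height s))"

abbreviation "time \<equiv> loop_time a b"

lemma ab_real: "real a < real b" "real b \<le> real N"
  using ab by auto

lemma time_in_unit: "real a \<le> h \<Longrightarrow> h \<le> real b \<Longrightarrow> time \<sigma> h \<in> {0..1}"
  using ab_real by (auto simp: loop_time_def Let_def field_simps)

lemma time_exists:
  assumes "s \<in> {0..1}"
  obtains \<sigma> h where "real a \<le> h" "h \<le> real b" "s = time \<sigma> h"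
proof
  have "0 \<le> 2 * (real b - real a) * min s (1 - s)"
    using assms ab_real by (intro mult_nonneg_nonneg) auto
  then show "real a \<le> height s"
    unfolding height_def by linarith
  have "min s (1 - s) \<le> 1/2"
    by (simp add: min_def)
  then have "2 * (real b - real a) * min s (1 - s) \<le> 2 * (real b - real a) * (1/2)"
    using ab_real by (intro mult_left_mono) auto
  moreover have "2 * (real b - real a) * (1/2) = real b - real a"
    by simp
  ultimately show "height s \<le> real b"
    unfolding height_def by linarith
  show "s = time (s \<le> 1/2) (height s)"
    using ab_real by (auto simp: loop_time_def height_def Let_def min_def)
qed

lemma height_time: "real a \<le> h \<Longrightarrow> h \<le> real b \<Longrightarrow> height (time \<sigma> h) = h"
  using ab_real by (auto simp: height_def loop_time_def Let_def min_def field_simps)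

lemma loop_time: "real a \<le> h \<Longrightarrow> h \<le> real b \<Longrightarrow> loop (time \<sigma> h) = pt h (polyline N (st \<sigma>) h)"
\<comment> \<open>At the top both strands have parameter 1/2, where \<open>loop\<close> evaluates
  the strand \<open>True\<close>; the common end makes this correct for \<open>False\<close> as
  well.\<close>
proof (cases "\<sigma> \<or> h = real b")
  case True
  assume h: "real a \<le> h" "h \<le> real b"
  have "time \<sigma> h \<le> 1/2"
    using h ab_real True by (auto simp: loop_time_def Let_def field_simps)
  moreover have "polyline N (st True) (real b) = polyline N (st False) (real b)"
    using ab ends by simp
  ultimately show ?thesis
    using h True by (cases \<sigma>) (auto simp: loop_def height_time)
next
  case False
  assume h: "real a \<le> h" "h \<le> real b"
  then have "\<not> time \<sigma> h \<le> 1/2"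
    using ab_real False by (auto simp: loop_time_def Let_def field_simps)
  then show ?thesis
    using h False by (auto simp: loop_def height_time)
qed

lemma path_image_loop: "path_image loop = strand N (st True) a b \<union> strand N (st False) a b"
proof
  show "path_image loop \<subseteq> strand N (st True) a b \<union> strand N (st False) a b"
  proof
    fix x assume "x \<in> path_image loop"
    then obtain \<sigma> h where "real a \<le> h" "h \<le> real b" "x = loop (time \<sigma> h)"
      unfolding path_image_def using time_exists by blast
    then show "x \<in> strand N (st True) a b \<union> strand N (st False) a b"
      by (cases \<sigma>) (auto simp: loop_time strand_def)
  qed
  have "strand N (st \<sigma>) a b \<subseteq> path_image loop" for \<sigma>
    unfolding strand_def path_image_def using loop_time time_in_unit
    by (smt (verit) atLeastAtMost_iff image_eqI image_subset_iff)
  then show "strand N (st True) a b \<union> strand N (st False) a b \<subseteq> path_image loop"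
    by simp
qed

text \<open>The strict bounds on \<open>h\<close> exclude the top, where both strands share the
  parameter 1/2. This makes the enumeration of crossings injective.\<close>

lemma time_inj:
  assumes "time \<sigma> h = time \<tau> k" "real a < h" "h < real b" "real a \<le> k" "k \<le> real b"
  shows "\<sigma> = \<tau> \<and> h = k"
proof -
  have "h = k"
    using assms height_time by (metis less_imp_le)
  then show ?thesis
    using assms ab_real by (cases \<sigma>; cases \<tau>) (auto simp: loop_time_def Let_def field_simps)
qed

lemma simple_path_loop: "simple_path loop"
  unfolding simple_path_def
proof
  have "continuous_on {0..1} height"
    unfolding height_def by (intro continuous_intros)
  then show "path loop"
    unfolding path_def loop_def
  proof (intro continuous_on_pt)
    assume h: "continuous_on {0..1} height"
    have "height s = real b" if "s * 2 = 1" for s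
    proof -
      have "s = 1/2"
        using that by simp
      then show ?thesis
        unfolding height_def by (simp only:) (simp add: field_simps)
    qed
    then have "continuous_on ({0..1/2} \<union> {1/2..1})
        (\<lambda>s. if s \<le> 1/2 then polyline N (st True) (height s) else polyline N (st False) (height s))"
      using ab ends
      by (intro continuous_on_If continuous_on_polyline' continuous_on_subset[OF h]) (auto simp: less_le_not_le)
    also have "{0..1/2} \<union> {1/2..1} = {0..1::real}"
      by auto
    finally show "continuous_on {0..1}
        (\<lambda>s. if s \<le> 1/2 then polyline N (st True) (height s) else polyline N (st False) (height s))" .
  qed
  show "loop_free loop"
    unfolding loop_free_def
  proof (intro ballI impI)
    fix x y :: real assume xy: "x \<in> {0..1}" "y \<in> {0..1}" "loop x = loop y"
    obtain \<sigma> h where h: "real a \<le> h" "h \<le> real b" "x = time \<sigma> h"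
      using time_exists[OF xy(1)] by blast
    obtain \<tau> k where k: "real a \<le> k" "k \<le> real b" "y = time \<tau> k"
      using time_exists[OF xy(2)] by blast
    have eq: "h = k" "polyline N (st \<sigma>) h = polyline N (st \<tau>) h"
      using xy(3) h k by (auto simp: loop_time)
    show "x = y \<or> x = 0 \<and> y = 1 \<or> x = 1 \<and> y = 0"
    proof (cases "\<sigma> = \<tau>")
      case False
      then have "polyline N (st True) h = polyline N (st False) h"
        using eq by (cases \<sigma>; cases \<tau>) auto
      \<comment> \<open>At the top the two parameters coincide; at the bottom they are 0 and 1, the
        one coincidence allowed by \<open>loop_free\<close>.\<close>
      then have "h = real a \<or> h = real b"
        using disj[of h] h by force
      then show ?thesis
        using h k eq ab_real by (auto simp: loop_time_def Let_def)
    qed (use h k eq in simp)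
  qed
qed

text \<open>The chain rule: the scalar is the derivative of the height with respect to the
  parameter, the vector is the slope of the strand over its height.\<close>

definition velocity :: "bool \<Rightarrow> nat \<Rightarrow> real^3" where
  "velocity \<sigma> n = (orient \<sigma> * (2 * (real b - real a))) *\<^sub>R pt 1 (st \<sigma> (Suc n) - st \<sigma> n)"

lemma loop_slab:
  assumes n: "a \<le> n" "n < b" and h: "real n \<le> h" "h \<le> real n + 1"
  shows "loop (time \<sigma> h) = time \<sigma> h *\<^sub>R velocity \<sigma> n + (pt (real n) (st \<sigma> n) - time \<sigma> (real n) *\<^sub>R velocity \<sigma> n)"
proof -
  have ivl: "real a \<le> h" "h \<le> real b" "n < N"
    using n h ab by linarith+
  have "time \<sigma> h - time \<sigma> (real n) = orient \<sigma> * ((h - real n) / (2 * (real b - real a)))"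
    by (simp add: loop_time_def Let_def diff_divide_distrib orient_def)
  then have "(time \<sigma> h - time \<sigma> (real n)) * (orient \<sigma> * (2 * (real b - real a))) = h - real n"
    using ab_real by (cases \<sigma>) (auto simp: orient_def divide_simps algebra_simps)
  then have "(time \<sigma> h - time \<sigma> (real n)) *\<^sub>R velocity \<sigma> n = (h - real n) *\<^sub>R pt 1 (st \<sigma> (Suc n) - st \<sigma> n)"
    unfolding velocity_def scaleR_scaleR by (simp only:)
  then have "time \<sigma> h *\<^sub>R velocity \<sigma> n + (pt (real n) (st \<sigma> n) - time \<sigma> (real n) *\<^sub>R velocity \<sigma> n) =
      pt (real n) (st \<sigma> n) + (h - real n) *\<^sub>R pt 1 (st \<sigma> (Suc n) - st \<sigma> n)"
    by (simp add: algebra_simps)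
  also have "\<dots> = pt h (polyline N (st \<sigma>) h)"
    using ivl h by (simp add: polyline_slab pt_add pt_scaleR)
  finally show ?thesis
    using ivl by (simp add: loop_time)
qed

lemma loop_derivative:
  assumes n: "a \<le> n" "n < b" and h: "real n < h" "h < real n + 1"
  shows "(loop has_vector_derivative velocity \<sigma> n) (at (time \<sigma> h))"
proof -
  define g where "g = (\<lambda>s. s *\<^sub>R velocity \<sigma> n + (pt (real n) (st \<sigma> n) - time \<sigma> (real n) *\<^sub>R velocity \<sigma> n))"
  \<comment> \<open>The inverse of \<open>time \<sigma>\<close> on the whole real line. The preimage
    of the open slab is an open neighbourhood of the parameter on which \<open>loop\<close> equals
    the affine map \<open>g\<close>.\<close>
  define k where "k = (\<lambda>s. real a + 2 * (real b - real a) * (if \<sigma> then s else 1 - s))"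
  have tk: "time \<sigma> (k s) = s" for s
    using ab_real by (simp add: k_def loop_time_def Let_def)
  have kt: "k (time \<sigma> h) = h"
    using ab_real by (simp add: k_def loop_time_def Let_def)
  have "continuous_on UNIV k"
    unfolding k_def by (cases \<sigma>) (auto intro!: continuous_intros)
  then have "open (k -` {real n<..<real n + 1})"
    by (simp add: open_vimage)
  moreover have "time \<sigma> h \<in> k -` {real n<..<real n + 1}"
    using h kt by simp
  moreover have "g s = loop s" if "s \<in> k -` {real n<..<real n + 1}" for s
    using loop_slab[OF n, of "k s" \<sigma>] that by (auto simp: tk g_def)
  moreover have "(g has_vector_derivative velocity \<sigma> n) (at (time \<sigma> h))"
    unfolding g_def by (auto intro!: derivative_eq_intros)
  ultimately show ?thesis
    using has_vector_derivative_transform_within_open by blast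
qed

lemma closed_polygonal_line_loop: "closed_polygonal_line loop"
  unfolding closed_polygonal_line_def
proof (intro conjI simple_path_loop)
  have "polyline N (st True) (real a) = polyline N (st False) (real a)"
    using ab ends by simp
  then show "pathfinish loop = pathstart loop"
    by (simp add: pathfinish_def pathstart_def loop_def height_def)
  show "piecewise_linear_on {0..1} loop"
  proof (rule piecewise_linear_on_unit_interval)
    show "0 < 2 * (b - a)"
      using ab by simp
    fix k assume k: "k < 2 * (b - a)"
    define \<sigma> where "\<sigma> = (k < b - a)"
    \<comment> \<open>The first \<open>b - a\<close> pieces climb from \<open>a\<close>; the later
      ones descend, piece \<open>b - a\<close> lying over the topmost slab
      \<open>b - 1\<close>.\<close>
    define n where "n = (if \<sigma> then a + k else 2 * b - a - Suc k)"
    have n: "a \<le> n" "n < b"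
      using k by (auto simp: n_def \<sigma>_def)
    have m: "real (2 * (b - a)) = 2 * (real b - real a)"
      using ab by (simp add: of_nat_diff)
    show "\<exists>D c. \<forall>s. real k \<le> real (2 * (b - a)) * s \<longrightarrow>
        real (2 * (b - a)) * s \<le> real k + 1 \<longrightarrow> loop s = s *\<^sub>R D + c"
      unfolding m
    proof (intro exI allI impI)
      fix s assume s: "real k \<le> 2 * (real b - real a) * s" "2 * (real b - real a) * s \<le> real k + 1"
      define h where "h = real a + 2 * (real b - real a) * (if \<sigma> then s else 1 - s)"
      have "time \<sigma> h = s"
        using ab_real by (simp add: h_def loop_time_def Let_def)
      moreover have "real n \<le> h" "h \<le> real n + 1"
      proof -
        have "h = (if \<sigma> then real a + 2 * (real b - real a) * s else 2 * real b - real a - 2 * (real b - real a) * s)"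
          by (simp add: h_def algebra_simps)
        moreover have "real n = (if \<sigma> then real a + real k else 2 * real b - real a - real k - 1)"
          using k ab by (auto simp: n_def of_nat_diff)
        ultimately show "real n \<le> h" "h \<le> real n + 1"
          using s by (auto split: if_splits)
      qed
      ultimately show "loop s = s *\<^sub>R velocity \<sigma> n + (pt (real n) (st \<sigma> n) - time \<sigma> (real n) *\<^sub>R velocity \<sigma> n)"
        using loop_slab[OF n, of h \<sigma>] by simp
    qed
  qed
qed

end

section \<open>Linking numbers of bigons\<close>

text \<open>All projections are along the third coordinate axis. If \<open>w\<close> and \<open>w'\<close> are the differences of
  two strands at consecutive levels, then the strands cross in between iff the real part changes sign,
  and the sign of the determinant of \<open>w\<close> and \<open>w'\<close> tells which strand is in front.\<close>

definition slab_sign :: "complex \<Rightarrow> complex \<Rightarrow> real" where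
  "slab_sign w w' = (if Re w * Re w' < 0 then sgn (Re w * Im w' - Im w * Re w') else 0)"

text \<open>Reversing a strand reverses the signs of its crossings, so the four pairs of strands
  enter with the product of their orientations. The projection preserves height, so only the slabs
  common to both curves matter.\<close>

definition crossing_sum :: "nat \<Rightarrow> nat \<Rightarrow> (bool \<Rightarrow> nat \<Rightarrow> complex) \<Rightarrow> (bool \<Rightarrow> nat \<Rightarrow> complex) \<Rightarrow> real" where
  "crossing_sum lo hi st st' = (\<Sum>\<sigma>\<in>UNIV. \<Sum>\<tau>\<in>UNIV. \<Sum>n\<in>{lo..<hi}.
     orient \<sigma> * orient \<tau> * slab_sign (st \<sigma> n - st' \<tau> n) (st \<sigma> (Suc n) - st' \<tau> (Suc n)))"

lemma affine_zero_iff: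
  fixes x y :: real
  assumes "x \<noteq> 0" "y \<noteq> 0" "0 \<le> u" "u \<le> 1"
  shows "x + u * (y - x) = 0 \<longleftrightarrow> x * y < 0 \<and> u = x / (x - y)"
proof
  assume eq: "x + u * (y - x) = 0"
  then have ne: "x \<noteq> y"
    using assms by auto
  then have u: "u = x / (x - y)"
    using eq by (simp add: field_simps)
  have "x * (1 - u) = - (u * y)"
    using eq by (simp add: algebra_simps)
  moreover have "u \<noteq> 0" "u \<noteq> 1"
    using eq assms by auto
  ultimately have *: "x * (x * (1 - u)) = - (u * (x * y))" and u_pos: "0 < u" "0 < 1 - u"
    using assms by auto
  have "0 < (x * x) * (1 - u)"
    using assms(1) u_pos(2) by (auto simp: zero_less_mult_iff linorder_neq_iff)
  then have "u * (x * y) < 0" "0 < u"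
    using * u_pos(1) by (auto simp only: mult.assoc)
  then have "x * y < 0"
    by (meson less_imp_le mult_nonneg_nonneg not_le)
  then show "x * y < 0 \<and> u = x / (x - y)"
    using u by blast
next
  assume "x * y < 0 \<and> u = x / (x - y)"
  moreover from this have "x \<noteq> y"
    by (auto simp: mult_less_0_iff)
  ultimately show "x + u * (y - x) = 0"
    by (simp add: field_simps)
qed

lemma opposite_signs_ratio:
  fixes x y :: real
  assumes "x * y < 0"
  shows "0 < x / (x - y)" "x / (x - y) < 1"
  using assms by (auto simp: mult_less_0_iff field_simps)

text \<open>Projecting along \<open>pt 0 \<i>\<close> keeps the height and the real part, so a
  crossing is a common height where the difference of two strands has real part 0. The assumption
  \<open>generic\<close> keeps crossings off the integer heights, where the curves may bend or
  end.\<close>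

lemma has_linking_number_bigons:
  assumes P: "bigon N a b st" and Q: "bigon N c d st'"
    and generic: "\<And>\<sigma> \<tau> n. max a c \<le> n \<Longrightarrow> n \<le> min b d \<Longrightarrow> Re (st \<sigma> n) \<noteq> Re (st' \<tau> n)"
    and disjoint: "path_image (bigon.loop N a b st) \<inter> path_image (bigon.loop N c d st') = {}"
    and sum: "2 * real_of_int z = crossing_sum (max a c) (min b d) st st'"
  shows "has_linking_number (bigon.loop N a b st) (bigon.loop N c d st') z"
proof -
  interpret P: bigon N a b st by fact
  interpret Q: bigon N c d st' by fact
  define lo hi where "lo = max a c" and "hi = min b d"
  have lohi: "hi \<le> N" "a \<le> lo" "c \<le> lo" "hi \<le> b" "hi \<le> d"
    using P.ab by (auto simp: lo_def hi_def)
  define w where "w = (\<lambda>\<sigma> \<tau> n. st \<sigma> n - st' \<tau> n)"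
  have w_nz: "Re (w \<sigma> \<tau> n) \<noteq> 0" if "lo \<le> n" "n \<le> hi" for \<sigma> \<tau> n
    using generic[of n \<sigma> \<tau>] that by (simp add: w_def lo_def hi_def)
  \<comment> \<open>\<open>K\<close> indexes the crossings by the two strands and the slab;
    \<open>h\<close> below is the height of such a crossing, the zero of the affine real
    part.\<close>
  define K where "K = {(\<sigma>, \<tau>, n). lo \<le> n \<and> n < hi \<and> Re (w \<sigma> \<tau> n) * Re (w \<sigma> \<tau> (Suc n)) < 0}"
  have K_sub: "K \<subseteq> UNIV \<times> UNIV \<times> {lo..<hi}"
    by (auto simp: K_def)
  then have finK: "finite K"
    by (rule finite_subset) (simp add: finite_cartesian_product)
  define h where "h = (\<lambda>(\<sigma>, \<tau>, n). real n + Re (w \<sigma> \<tau> n) / (Re (w \<sigma> \<tau> n) - Re (w \<sigma> \<tau> (Suc n))))"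
  have h: "real n < h (\<sigma>, \<tau>, n)" "h (\<sigma>, \<tau>, n) < real n + 1" if "(\<sigma>, \<tau>, n) \<in> K" for \<sigma> \<tau> n
    using opposite_signs_ratio[of "Re (w \<sigma> \<tau> n)" "Re (w \<sigma> \<tau> (Suc n))"] that
    by (auto simp: K_def h_def)
  have h_range: "real a < h k" "h k < real b" "real c < h k" "h k < real d" if kK: "k \<in> K" for k
  proof -
    obtain \<sigma> \<tau> n where k: "k = (\<sigma>, \<tau>, n)"
      by (cases k)
    have "lo \<le> n" "Suc n \<le> hi"
      using kK k by (auto simp: K_def)
    then have "a \<le> n" "c \<le> n" "Suc n \<le> b" "Suc n \<le> d"
      using lohi by linarith+
    then show "real a < h k" "h k < real b" "real c < h k" "h k < real d"
      using h[of \<sigma> \<tau> n] kK k by auto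
  qed
  have polyline_w: "polyline N (st \<sigma>) x - polyline N (st' \<tau>) x = w \<sigma> \<tau> n + (x - real n) *\<^sub>R (w \<sigma> \<tau> (Suc n) - w \<sigma> \<tau> n)"
    if "n < hi" "real n \<le> x" "x \<le> real n + 1" for \<sigma> \<tau> n x
    using that lohi polyline_slab[of n N x "w \<sigma> \<tau>"] by (simp add: polyline_diff w_def)
  have zero_iff: "Re (polyline N (st \<sigma>) x - polyline N (st' \<tau>) x) = 0 \<longleftrightarrow> (\<exists>n. (\<sigma>, \<tau>, n) \<in> K \<and> x = h (\<sigma>, \<tau>, n))"
    if x: "real lo \<le> x" "x \<le> real hi" for \<sigma> \<tau> x
  proof
    assume 0: "Re (polyline N (st \<sigma>) x - polyline N (st' \<tau>) x) = 0"
    \<comment> \<open>A single common level contains no slab; there a zero would contradict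
      genericity directly.\<close>
    have "lo \<noteq> hi"
    proof
      assume "lo = hi"
      then have "x = real lo"
        using x by simp
      then have "Re (w \<sigma> \<tau> lo) = 0"
        using 0 lohi \<open>lo = hi\<close> by (simp add: w_def)
      then show False
        using w_nz[of lo] \<open>lo = hi\<close> by simp
    qed
    moreover have "lo \<le> hi"
      using x by linarith
    ultimately obtain n where n: "lo \<le> n" "n < hi" "real n \<le> x" "x \<le> real n + 1"
      using slab_cases[OF x] by (metis le_neq_implies_less)
    have "Re (w \<sigma> \<tau> n) + (x - real n) * (Re (w \<sigma> \<tau> (Suc n)) - Re (w \<sigma> \<tau> n)) = 0"
      using 0 polyline_w[of n x \<sigma> \<tau>] n by simp
    then have "Re (w \<sigma> \<tau> n) * Re (w \<sigma> \<tau> (Suc n)) < 0"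
      "x - real n = Re (w \<sigma> \<tau> n) / (Re (w \<sigma> \<tau> n) - Re (w \<sigma> \<tau> (Suc n)))"
      using affine_zero_iff[of "Re (w \<sigma> \<tau> n)" "Re (w \<sigma> \<tau> (Suc n))" "x - real n"] w_nz n by auto
    then show "\<exists>n. (\<sigma>, \<tau>, n) \<in> K \<and> x = h (\<sigma>, \<tau>, n)"
      using n by (intro exI[of _ n]) (auto simp: K_def h_def)
  next
    assume "\<exists>n. (\<sigma>, \<tau>, n) \<in> K \<and> x = h (\<sigma>, \<tau>, n)"
    then obtain n where n: "(\<sigma>, \<tau>, n) \<in> K" "x = h (\<sigma>, \<tau>, n)"
      by blast
    have "n < hi" "real n \<le> x" "x \<le> real n + 1" "lo \<le> n"
      using n h[OF n(1)] by (auto simp: K_def)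
    then show "Re (polyline N (st \<sigma>) x - polyline N (st' \<tau>) x) = 0"
      using polyline_w[of n x \<sigma> \<tau>] affine_zero_iff[of "Re (w \<sigma> \<tau> n)" "Re (w \<sigma> \<tau> (Suc n))" "x - real n"] w_nz n
      by (auto simp: K_def h_def)
  qed
  define F where "F = (\<lambda>k. (P.time (fst k) (h k), Q.time (fst (snd k)) (h k)))"
  define v where "v = pt 0 \<i>"
  have crossings: "crossings v P.loop Q.loop = F ` K"
  proof (intro equalityI subsetI)
    fix x assume "x \<in> crossings v P.loop Q.loop"
    then obtain s t r where st: "x = (s, t)" "s \<in> {0..1}" "t \<in> {0..1}" "P.loop s - Q.loop t = r *\<^sub>R v"
      by (auto simp: crossings_def)
    obtain \<sigma> y where y: "real a \<le> y" "y \<le> real b" "s = P.time \<sigma> y"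
      using P.time_exists[OF st(2)] by blast
    obtain \<tau> y' where y': "real c \<le> y'" "y' \<le> real d" "t = Q.time \<tau> y'"
      using Q.time_exists[OF st(3)] by blast
    have "pt y (polyline N (st \<sigma>) y) - pt y' (polyline N (st' \<tau>) y') = pt 0 (r *\<^sub>R \<i>)"
      using st(4) y y' by (simp add: P.loop_time Q.loop_time v_def pt_scaleR)
    then have "y' = y" "polyline N (st \<sigma>) y - polyline N (st' \<tau>) y = r *\<^sub>R \<i>"
      by (auto simp: pt_diff)
    then have "Re (polyline N (st \<sigma>) y - polyline N (st' \<tau>) y) = 0"
      by simp
    moreover have "real lo \<le> y" "y \<le> real hi"
      using y y' \<open>y' = y\<close> by (auto simp: lo_def hi_def)
    ultimately obtain n where "(\<sigma>, \<tau>, n) \<in> K" "y = h (\<sigma>, \<tau>, n)"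
      using zero_iff by blast
    then show "x \<in> F ` K"
      using y y' \<open>y' = y\<close> st(1) by (intro image_eqI[of _ _ "(\<sigma>, \<tau>, n)"]) (auto simp: F_def)
  next
    fix x assume "x \<in> F ` K"
    then obtain \<sigma> \<tau> n where k: "(\<sigma>, \<tau>, n) \<in> K" "x = F (\<sigma>, \<tau>, n)"
      by auto
    let ?y = "h (\<sigma>, \<tau>, n)"
    have r: "real a \<le> ?y" "?y \<le> real b" "real c \<le> ?y" "?y \<le> real d"
      using h_range[OF k(1)] by auto
    then have "real lo \<le> ?y" "?y \<le> real hi"
      by (auto simp: lo_def hi_def)
    then have "Re (polyline N (st \<sigma>) ?y - polyline N (st' \<tau>) ?y) = 0"
      using zero_iff k by blast
    then have "P.loop (P.time \<sigma> ?y) - Q.loop (Q.time \<tau> ?y) =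
        Im (polyline N (st \<sigma>) ?y - polyline N (st' \<tau>) ?y) *\<^sub>R v"
      using r by (simp add: P.loop_time Q.loop_time vec3_eq_iff v_def)
    then show "x \<in> crossings v P.loop Q.loop"
      using r k(2) P.time_in_unit Q.time_in_unit unfolding crossings_def F_def by auto
  qed
  have inj: "inj_on F K"
  proof (rule inj_onI)
    fix k l assume kl: "k \<in> K" "l \<in> K" "F k = F l"
    obtain \<sigma> \<tau> n where k: "k = (\<sigma>, \<tau>, n)"
      by (cases k)
    obtain \<sigma>' \<tau>' m where l: "l = (\<sigma>', \<tau>', m)"
      by (cases l)
    have "\<sigma> = \<sigma>' \<and> h k = h l" "\<tau> = \<tau>' \<and> h k = h l"
      using kl(3) P.time_inj[of \<sigma> "h k" \<sigma>' "h l"] Q.time_inj[of \<tau> "h k" \<tau>' "h l"]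
        h_range[OF kl(1)] h_range[OF kl(2)] by (auto simp: F_def k l)
    moreover have "n = m"
      using h[of \<sigma> \<tau> n] h[of \<sigma>' \<tau>' m] kl calculation unfolding k l by auto
    ultimately show "k = l"
      by (simp add: k l)
  qed
  define J where "J = (\<lambda>\<sigma> \<tau>. orient \<sigma> * (2 * (real b - real a)) * (orient \<tau> * (2 * (real d - real c))))"
  have J: "sgn (J \<sigma> \<tau> * y) = orient \<sigma> * orient \<tau> * sgn y" for \<sigma> \<tau> y
    using P.ab_real Q.ab_real by (auto simp: J_def orient_def sgn_mult)
  have J_nz: "J \<sigma> \<tau> \<noteq> 0" for \<sigma> \<tau>
    using P.ab_real Q.ab_real by (auto simp: J_def orient_def)
  \<comment> \<open>Up to the scalars collected in \<open>J\<close>, both velocities have first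
    coordinate 1 and the third row has first coordinate 0. Subtracting rows leaves a 2 by 2
    determinant of the slope of the difference \<open>w\<close> and \<open>u\<close>.\<close>
  have det: "det (vector [P.velocity \<sigma> n, Q.velocity \<tau> n, pt 0 u] :: real^3^3) =
      J \<sigma> \<tau> * ((Re (w \<sigma> \<tau> n) - Re (w \<sigma> \<tau> (Suc n))) * Im u
        + (Im (w \<sigma> \<tau> (Suc n)) - Im (w \<sigma> \<tau> n)) * Re u)" for \<sigma> \<tau> n u
    by (simp add: det_3 P.velocity_def Q.velocity_def J_def orient_def w_def) (simp add: algebra_simps)
  have deriv: "(P.loop has_vector_derivative P.velocity \<sigma> n) (at (P.time \<sigma> (h (\<sigma>, \<tau>, n))))"
     "(Q.loop has_vector_derivative Q.velocity \<tau> n) (at (Q.time \<tau> (h (\<sigma>, \<tau>, n))))"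
    if K: "(\<sigma>, \<tau>, n) \<in> K" for \<sigma> \<tau> n
    using K h[OF K] lohi by (auto intro!: P.loop_derivative Q.loop_derivative simp: K_def)
  have "generic_direction v P.loop Q.loop"
    unfolding generic_direction_def
  proof (intro conjI)
    show "v \<noteq> 0"
      by (auto simp: v_def vec3_eq_iff)
    show "finite (crossings v P.loop Q.loop)"
      using finK crossings by simp
    show "\<forall>(s, t)\<in>crossings v P.loop Q.loop. s \<in> {0<..<1} \<and> t \<in> {0<..<1} \<and>
        P.loop differentiable at s \<and> Q.loop differentiable at t \<and>
        det (vector [vector_derivative P.loop (at s), vector_derivative Q.loop (at t), v] :: real^3^3) \<noteq> 0"
      unfolding crossings
    proof clarify
      fix s t \<sigma> \<tau> n assume k: "(\<sigma>, \<tau>, n) \<in> K" "(s, t) = F (\<sigma>, \<tau>, n)"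
      let ?y = "h (\<sigma>, \<tau>, n)"
      have st: "s = P.time \<sigma> ?y" "t = Q.time \<tau> ?y"
        using k(2) by (simp_all add: F_def)
      have "s \<in> {0<..<1}" "t \<in> {0<..<1}"
        using h_range[OF k(1)] by (auto simp: st loop_time_def Let_def field_simps)
      moreover have "vector_derivative P.loop (at s) = P.velocity \<sigma> n" "vector_derivative Q.loop (at t) = Q.velocity \<tau> n"
        using deriv[OF k(1)] by (auto simp: st vector_derivative_at)
      \<comment> \<open>With \<open>u = \<i>\<close> the determinant is \<open>J\<close> times the
        drop of the real part of \<open>w\<close>, which is nonzero because that part changes
        sign.\<close>
      moreover have "det (vector [P.velocity \<sigma> n, Q.velocity \<tau> n, v] :: real^3^3) \<noteq> 0"
        using k(1) J_nz by (auto simp: v_def det K_def)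
      ultimately show "s \<in> {0<..<1} \<and> t \<in> {0<..<1} \<and>
          P.loop differentiable at s \<and> Q.loop differentiable at t \<and>
          det (vector [vector_derivative P.loop (at s), vector_derivative Q.loop (at t), v] :: real^3^3) \<noteq> 0"
        using deriv[OF k(1)] by (auto simp: st intro: differentiableI_vector)
    qed
  qed
  moreover have "(\<Sum>x\<in>crossings v P.loop Q.loop. crossing_sign P.loop Q.loop x) = crossing_sum lo hi st st'"
  proof -
    have sign: "crossing_sign P.loop Q.loop (F (\<sigma>, \<tau>, n)) =
        orient \<sigma> * orient \<tau> * slab_sign (w \<sigma> \<tau> n) (w \<sigma> \<tau> (Suc n))" if k: "(\<sigma>, \<tau>, n) \<in> K" for \<sigma> \<tau> n
    proof -
      let ?y = "h (\<sigma>, \<tau>, n)"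
      define D where "D = polyline N (st \<sigma>) ?y - polyline N (st' \<tau>) ?y"
      define x x' y y' where "x = Re (w \<sigma> \<tau> n)" "x' = Re (w \<sigma> \<tau> (Suc n))" "y = Im (w \<sigma> \<tau> n)" "y' = Im (w \<sigma> \<tau> (Suc n))"
      note defs = this
      have neg: "x * x' < 0" and n: "n < hi" "real n \<le> ?y" "?y \<le> real n + 1"
        using k h[OF k] by (auto simp: K_def defs)
      then have ne: "x - x' \<noteq> 0"
        by (auto simp: mult_less_0_iff)
      have "real lo \<le> ?y" "?y \<le> real hi"
        using h_range[OF k] by (auto simp: lo_def hi_def)
      then have ReD: "Re D = 0"
        unfolding D_def using k zero_iff by blast
      have "Im D = y + x / (x - x') * (y' - y)"
        unfolding D_def polyline_w[OF n] by (simp add: h_def defs)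
      \<comment> \<open>Clearing the denominator turns the offset of the strands at the crossing
        into the determinant of \<open>w\<close> at the two levels, the quantity in
        \<open>slab_sign\<close>.\<close>
      then have ImD: "(x - x') * Im D = x * y' - y * x'"
        using ne by (simp add: field_simps)
      have "P.loop (P.time \<sigma> ?y) - Q.loop (Q.time \<tau> ?y) = pt 0 D"
        using h_range[OF k] by (simp add: P.loop_time Q.loop_time pt_diff D_def)
      then have "crossing_sign P.loop Q.loop (F (\<sigma>, \<tau>, n)) = sgn (det (vector [P.velocity \<sigma> n, Q.velocity \<tau> n, pt 0 D] :: real^3^3))"
        using deriv[OF k] by (simp add: crossing_sign_def F_def vector_derivative_at)
      also have "\<dots> = sgn (J \<sigma> \<tau> * ((x - x') * Im D))"
        by (simp add: det ReD defs)
      also have "\<dots> = orient \<sigma> * orient \<tau> * slab_sign (w \<sigma> \<tau> n) (w \<sigma> \<tau> (Suc n))"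
        unfolding ImD J using neg by (simp add: slab_sign_def defs)
      finally show ?thesis .
    qed
    have "(\<Sum>x\<in>crossings v P.loop Q.loop. crossing_sign P.loop Q.loop x) =
        (\<Sum>(\<sigma>, \<tau>, n)\<in>K. orient \<sigma> * orient \<tau> * slab_sign (w \<sigma> \<tau> n) (w \<sigma> \<tau> (Suc n)))"
      unfolding crossings sum.reindex[OF inj] by (intro sum.cong) (auto simp: sign)
    also have "\<dots> = (\<Sum>(\<sigma>, \<tau>, n)\<in>UNIV \<times> UNIV \<times> {lo..<hi}. orient \<sigma> * orient \<tau> * slab_sign (w \<sigma> \<tau> n) (w \<sigma> \<tau> (Suc n)))"
      by (intro sum.mono_neutral_left K_sub) (auto simp: K_def slab_sign_def finite_cartesian_product split: if_splits)
    also have "\<dots> = crossing_sum lo hi st st'"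
      by (simp add: crossing_sum_def w_def sum.cartesian_product split_def)
    finally show ?thesis .
  qed
  ultimately show ?thesis
    unfolding has_linking_number_def
    using P.closed_polygonal_line_loop Q.closed_polygonal_line_loop disjoint sum
    by (auto simp: lo_def hi_def)
qed

section \<open>Drawings of K6 with monotone edges\<close>

text \<open>Barycentric coordinates turn questions about intersecting edges into questions about
  supports.\<close>

lemma mem_K6_edge:
  assumes "i \<noteq> j"
  shows "x \<in> K6_edge i j \<longleftrightarrow> (\<forall>m. 0 \<le> x$m) \<and> x$i + x$j = 1 \<and> (\<forall>m. m \<noteq> i \<longrightarrow> m \<noteq> j \<longrightarrow> x$m = 0)"
proof
  assume "x \<in> K6_edge i j"
  then obtain u where "0 \<le> u" "u \<le> 1" "x = (1 - u) *\<^sub>R axis i 1 + u *\<^sub>R axis j 1"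
    unfolding K6_edge_def in_segment by blast
  then show "(\<forall>m. 0 \<le> x$m) \<and> x$i + x$j = 1 \<and> (\<forall>m. m \<noteq> i \<longrightarrow> m \<noteq> j \<longrightarrow> x$m = 0)"
    using assms by (auto simp: axis_def)
next
  assume x: "(\<forall>m. 0 \<le> x$m) \<and> x$i + x$j = 1 \<and> (\<forall>m. m \<noteq> i \<longrightarrow> m \<noteq> j \<longrightarrow> x$m = 0)"
  have eq: "1 - x$j = x$i"
    using x by (metis add_diff_cancel_right')
  have le: "x$j \<le> 1"
    using x eq by (metis diff_ge_0_iff_ge)
  have "x = (1 - x$j) *\<^sub>R axis i 1 + x$j *\<^sub>R axis j 1"
    unfolding eq using assms x by (auto simp: vec_eq_iff axis_def)
  then show "x \<in> K6_edge i j"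
    unfolding K6_edge_def in_segment using x le by blast
qed

lemma K6_edge_commute: "K6_edge i j = K6_edge j i"
  by (simp add: K6_edge_def closed_segment_commute)

lemma axis_in_K6_edge: "axis i 1 \<in> K6_edge i j" "axis j 1 \<in> K6_edge i j"
  by (simp_all add: K6_edge_def)

text \<open>The support of a common point lies in two different two-element sets, hence is a single
  vertex.\<close>

lemma K6_edges_meet:
  assumes "i \<noteq> j" "k \<noteq> l" "{i, j} \<noteq> {k, l}" "x \<in> K6_edge i j" "x \<in> K6_edge k l"
  obtains m where "m \<in> {i, j} \<inter> {k, l}" "x = axis m 1"
proof -
  have ij: "\<And>m. 0 \<le> x$m" "x$i + x$j = 1" "\<And>m. m \<noteq> i \<Longrightarrow> m \<noteq> j \<Longrightarrow> x$m = 0"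
    and kl: "x$k + x$l = 1" "\<And>m. m \<noteq> k \<Longrightarrow> m \<noteq> l \<Longrightarrow> x$m = 0"
    using assms(4,5) unfolding mem_K6_edge[OF assms(1)] mem_K6_edge[OF assms(2)] by blast+
  have *: thesis if "m \<in> {i, j}" "m \<in> {k, l}" "\<And>m'. m' \<noteq> m \<Longrightarrow> x$m' = 0" for m
  proof -
    have "x$m = 1"
      using that ij assms by (cases "m = i") auto
    then have "x = axis m 1"
      using that(3) by (auto simp: vec_eq_iff axis_def)
    then show thesis
      using \<open>\<And>m. m \<in> {i, j} \<inter> {k, l} \<Longrightarrow> x = axis m 1 \<Longrightarrow> thesis\<close> that by blast
  qed
  consider "i \<notin> {k, l}" | "j \<notin> {k, l}"
    using assms(1-3) by (auto simp: doubleton_eq_iff)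
  then show thesis
  proof cases
    case 1
    then have "x$i = 0"
      using kl(2) by blast
    then have "x$j \<noteq> 0" "\<And>m'. m' \<noteq> j \<Longrightarrow> x$m' = 0"
      using ij by force+
    moreover from this have "j \<in> {k, l}"
      using kl(2) by blast
    ultimately show thesis
      using *[of j] by blast
  next
    case 2
    then have "x$j = 0"
      using kl(2) by blast
    then have "x$i \<noteq> 0" "\<And>m'. m' \<noteq> i \<Longrightarrow> x$m' = 0"
      using ij by force+
    moreover from this have "i \<in> {k, l}"
      using kl(2) by blast
    ultimately show thesis
      using *[of i] by blast
  qed
qed

text \<open>Disjointness of edges concerns all real heights; \<open>level\<close> and
  \<open>slab\<close> reduce it to integer ones. The first excludes coincidences of the projected
  edges at levels other than shared vertices, the second says that at a projected crossing inside a
  slab one edge is strictly in front. The same two conditions yield both the embedding and a generic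
  projection.\<close>

locale monotone_drawing =
  fixes N :: nat and lv :: "6 \<Rightarrow> nat" and V :: "6 \<Rightarrow> complex" and W :: "6 \<Rightarrow> 6 \<Rightarrow> nat \<Rightarrow> complex"
  assumes lv_inj: "inj lv" and lv_le: "\<And>i. lv i \<le> N"
    and W_commute: "\<And>i j. W i j = W j i"
    and W_lv: "\<And>i j. i \<noteq> j \<Longrightarrow> W i j (lv i) = V i"
    and level: "\<And>i j k l n. (i, j) \<noteq> (k, l) \<Longrightarrow> lv i < lv j \<Longrightarrow> lv k < lv l \<Longrightarrow>
      lv i \<le> n \<Longrightarrow> n \<le> lv j \<Longrightarrow> lv k \<le> n \<Longrightarrow> n \<le> lv l \<Longrightarrow> Re (W i j n) = Re (W k l n) \<Longrightarrow>
      \<exists>m \<in> {i, j} \<inter> {k, l}. n = lv m"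
    and slab: "\<And>i j k l n. (i, j) \<noteq> (k, l) \<Longrightarrow> lv i \<le> n \<Longrightarrow> n < lv j \<Longrightarrow> lv k \<le> n \<Longrightarrow> n < lv l \<Longrightarrow>
      Re (W i j n - W k l n) * Re (W i j (Suc n) - W k l (Suc n)) < 0 \<Longrightarrow>
      Re (W i j n - W k l n) * Im (W i j (Suc n) - W k l (Suc n)) \<noteq>
      Im (W i j n - W k l n) * Re (W i j (Suc n) - W k l (Suc n))"
begin

lemma lv_eq_iff [simp]: "lv i = lv j \<longleftrightarrow> i = j"
  using lv_inj by (auto simp: inj_def)

lemma lv_less_imp_neq: "lv i < lv j \<Longrightarrow> i \<noteq> j"
  by auto

lemma W_lv': "i \<noteq> j \<Longrightarrow> W i j (lv j) = V j"
  using W_lv[of j i] W_commute by simp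

text \<open>The difference of two strands is affine in a slab. If it vanishes strictly inside, its
  values at the two levels are negative multiples of each other: the real parts change sign and the
  determinant is 0, against \<open>slab\<close>.\<close>

lemma strands_meet:
  assumes ne: "(i, j) \<noteq> (k, l)" and ij: "lv i < lv j" and kl: "lv k < lv l"
    and h: "real (lv i) \<le> h" "h \<le> real (lv j)" "real (lv k) \<le> h" "h \<le> real (lv l)"
    and eq: "polyline N (W i j) h = polyline N (W k l) h"
  shows "\<exists>m \<in> {i, j} \<inter> {k, l}. h = real (lv m)"
proof -
  define lo hi where "lo = max (lv i) (lv k)" and "hi = min (lv j) (lv l)"
  have lohi: "real lo \<le> h" "h \<le> real hi"
    using h by (auto simp: lo_def hi_def)
  have int: "\<exists>m \<in> {i, j} \<inter> {k, l}. h = real (lv m)" if hn: "h = real n" for n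
  proof -
    have n: "lv i \<le> n" "n \<le> lv j" "lv k \<le> n" "n \<le> lv l"
      using h hn by auto
    moreover have "n \<le> N"
      using n(2) lv_le le_trans by blast
    then have "W i j n = W k l n"
      using eq unfolding hn by simp
    ultimately show ?thesis
      using level[OF ne ij kl] hn by fastforce
  qed
  show ?thesis
  proof (cases "lo < hi")
    case False
    then have "h = real lo"
      using lohi by linarith
    then show ?thesis
      by (rule int)
  next
    case True
    then obtain n where n: "lo \<le> n" "n < hi" "real n \<le> h" "h \<le> real n + 1"
      using slab_cases lohi by metis
    then have n': "lv i \<le> n" "n < lv j" "lv k \<le> n" "n < lv l"
      by (auto simp: lo_def hi_def)
    define w where "w = (\<lambda>n. W i j n - W k l n)"
    define u where "u = h - real n"
    have u: "0 \<le> u" "u \<le> 1"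
      using n by (auto simp: u_def)
    have "n < N"
      using n' lv_le[of j] by simp
    then have 0: "w n + u *\<^sub>R (w (Suc n) - w n) = 0"
      using n eq polyline_slab[of n N h w] by (simp add: w_def u_def polyline_diff[symmetric])
    show ?thesis
    proof (cases "h = real n \<or> h = real (Suc n)")
      case True
      then show ?thesis
        using int by blast
    next
      case False
      then have u': "u \<noteq> 0" "u \<noteq> 1"
        by (auto simp: u_def)
      have Re0: "Re (w n) + u * (Re (w (Suc n)) - Re (w n)) = 0"
        and Im0: "Im (w n) + u * (Im (w (Suc n)) - Im (w n)) = 0"
        using arg_cong[OF 0, of Re] arg_cong[OF 0, of Im] by simp_all
      have *: "(1 - u) * Re (w n) = - u * Re (w (Suc n))" "(1 - u) * Im (w n) = - u * Im (w (Suc n))"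
        using Re0 Im0 by (simp_all add: algebra_simps)
      \<comment> \<open>Otherwise the real parts agree at both levels, so by \<open>level\<close>
        both edges run from the same vertex at \<open>n\<close> to the same vertex at
        \<open>Suc n\<close> and are equal.\<close>
      have nz: "Re (w n) \<noteq> 0"
      proof
        assume "Re (w n) = 0"
        then have "Re (w (Suc n)) = 0"
          using * u' by simp
        obtain m where m: "m \<in> {i, j} \<inter> {k, l}" "n = lv m"
          using level[OF ne ij kl, of n] \<open>Re (w n) = 0\<close> n' by (auto simp: w_def)
        obtain m' where m': "m' \<in> {i, j} \<inter> {k, l}" "Suc n = lv m'"
          using level[OF ne ij kl, of "Suc n"] \<open>Re (w (Suc n)) = 0\<close> n' by (auto simp: w_def)
        have "m = i" "m = k" "m' = j" "m' = l"
          using m m' n' by auto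
        then show False
          using ne by simp
      qed
      then have nz': "Re (w (Suc n)) \<noteq> 0"
        using * u' by auto
      then have neg: "Re (w n) * Re (w (Suc n)) < 0"
        using affine_zero_iff[OF nz nz' u] Re0 by blast
      have "(1 - u) * (Re (w n) * Im (w (Suc n))) = (1 - u) * (Im (w n) * Re (w (Suc n)))"
        using * by (simp add: mult.assoc[symmetric])
      then have "Re (w n) * Im (w (Suc n)) = Im (w n) * Re (w (Suc n))"
        using u' by simp
      then show ?thesis
        using slab[OF ne n'] neg by (simp add: w_def)
    qed
  qed
qed

section \<open>The map on K6 defined by a monotone drawing, and its piecewise linearity\<close>

definition hgt :: "real^6 \<Rightarrow> real" where
  "hgt x = (\<Sum>m\<in>UNIV. x$m * real (lv m))"

lemma linear_hgt: "linear hgt"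
  by (intro linearI) (simp_all add: hgt_def sum.distrib sum_distrib_left algebra_simps)

lemma continuous_on_hgt: "continuous_on S hgt"
  by (intro linear_continuous_on linear_conv_bounded_linear[THEN iffD1] linear_hgt)

lemma hgt_axis [simp]: "hgt (axis i 1) = real (lv i)"
  by (simp add: hgt_def axis_def if_distrib[of "\<lambda>x. x * _"] cong: if_cong)

definition edge_point :: "6 \<Rightarrow> 6 \<Rightarrow> real \<Rightarrow> real^6" where
  "edge_point i j h = axis i 1 + ((h - real (lv i)) / (real (lv j) - real (lv i))) *\<^sub>R (axis j 1 - axis i 1)"

lemma edge_point_ends [simp]:
  "i \<noteq> j \<Longrightarrow> edge_point i j (real (lv i)) = axis i 1"
  "i \<noteq> j \<Longrightarrow> edge_point i j (real (lv j)) = axis j 1"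
  by (simp_all add: edge_point_def)

lemma hgt_edge_point [simp]: "i \<noteq> j \<Longrightarrow> hgt (edge_point i j h) = h"
  using linear_add[OF linear_hgt] linear_diff[OF linear_hgt] linear_scale[OF linear_hgt]
  by (simp add: edge_point_def)

lemma edge_point_convex:
  "(1 - u) *\<^sub>R edge_point i j h + u *\<^sub>R edge_point i j h' = edge_point i j ((1 - u) * h + u * h')"
proof -
  define d where "d = real (lv j) - real (lv i)"
  have "((1 - u) * h + u * h' - real (lv i)) / d = (1 - u) * ((h - real (lv i)) / d) + u * ((h' - real (lv i)) / d)"
    by (cases "d = 0") (simp_all add: field_simps)
  then show ?thesis
    unfolding edge_point_def d_def[symmetric] by (simp only:) (simp add: algebra_simps)
qed

lemma closed_segment_edge_point:
  assumes "i \<noteq> j" "h \<le> h'"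
  shows "closed_segment (edge_point i j h) (edge_point i j h') = edge_point i j ` {h..h'}"
proof -
  have "closed_segment (edge_point i j h) (edge_point i j h') = edge_point i j ` closed_segment h h'"
    unfolding closed_segment_def by (auto simp: edge_point_convex)
  then show ?thesis
    using assms by (simp add: closed_segment_eq_real_ivl)
qed

lemma K6_edge_eq_image:
  assumes "lv i < lv j"
  shows "K6_edge i j = edge_point i j ` {real (lv i)..real (lv j)}"
  using assms closed_segment_edge_point[of i j "real (lv i)" "real (lv j)"]
  by (auto simp: K6_edge_def)

lemma edge_point_hgt:
  assumes "lv i < lv j" "x \<in> K6_edge i j"
  shows "edge_point i j (hgt x) = x" "real (lv i) \<le> hgt x" "hgt x \<le> real (lv j)"
  using assms lv_less_imp_neq[OF assms(1)] by (auto simp: K6_edge_eq_image)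

text \<open>A vertex lies on several edges; \<open>drawing_edge\<close> shows that the choice among
  them does not affect the value.\<close>

definition drawing :: "real^6 \<Rightarrow> real^3" where
  "drawing x = (let (i, j) = SOME (i, j). i \<noteq> j \<and> x \<in> K6_edge i j in pt (hgt x) (polyline N (W i j) (hgt x)))"

lemma drawing_axis_aux: "i \<noteq> j \<Longrightarrow> m \<in> {i, j} \<Longrightarrow> polyline N (W i j) (real (lv m)) = V m"
  using lv_le by (auto simp: W_lv W_lv')

lemma drawing_edge:
  assumes "i \<noteq> j" "x \<in> K6_edge i j"
  shows "drawing x = pt (hgt x) (polyline N (W i j) (hgt x))"
proof -
  define p where "p = (SOME (i, j). i \<noteq> j \<and> x \<in> K6_edge i j)"
  obtain k l where p: "p = (k, l)"
    by (cases p)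
  have "case p of (k, l) \<Rightarrow> k \<noteq> l \<and> x \<in> K6_edge k l"
    unfolding p_def by (rule someI[of _ "(i, j)"]) (use assms in simp)
  then have kl: "k \<noteq> l" "x \<in> K6_edge k l"
    by (auto simp: p)
  have "polyline N (W k l) (hgt x) = polyline N (W i j) (hgt x)"
  proof (cases "{i, j} = {k, l}")
    case True
    then show ?thesis
      using W_commute by (auto simp: doubleton_eq_iff)
  next
    case False
    then obtain m where "m \<in> {i, j} \<inter> {k, l}" "x = axis m 1"
      using K6_edges_meet assms kl by metis
    then show ?thesis
      using assms kl drawing_axis_aux[of i j m] drawing_axis_aux[of k l m] by auto
  qed
  then show ?thesis
    by (simp add: drawing_def p_def[symmetric] p)
qed

lemma drawing_image_edge:
  assumes "lv i < lv j"
  shows "drawing ` K6_edge i j = strand N (W i j) (lv i) (lv j)"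
proof -
  have "drawing ` K6_edge i j = (\<lambda>x. pt (hgt x) (polyline N (W i j) (hgt x))) ` K6_edge i j"
    using assms by (intro image_cong refl drawing_edge) auto
  then show ?thesis
    using assms lv_less_imp_neq[OF assms] by (simp add: K6_edge_eq_image strand_def image_image)
qed

lemma K6_cases:
  assumes "x \<in> K6"
  obtains i j where "lv i < lv j" "x \<in> K6_edge i j"
proof -
  obtain i j where ij: "x \<in> K6_edge i j"
    using assms by (auto simp: K6_def)
  have *: thesis if "k \<noteq> l" "x \<in> K6_edge k l" for k l
    using that \<open>\<And>i j. lv i < lv j \<Longrightarrow> x \<in> K6_edge i j \<Longrightarrow> thesis\<close> K6_edge_commute
    by (metis lv_eq_iff nat_neq_iff)
  show thesis
  \<comment> \<open>\<open>K6\<close> also unites the degenerate edges with \<open>i = j\<close>;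
    such a point is a vertex and lies on the edge to \<open>i + 1\<close>.\<close>
  proof (cases "i = j")
    case True
    then have "x = axis i 1"
      using ij by (simp add: K6_edge_def)
    moreover have "i \<noteq> i + 1"
      by simp
    ultimately show thesis
      using *[of i "i + 1"] axis_in_K6_edge by blast
  qed (use * ij in blast)
qed

lemma inj_on_drawing: "inj_on drawing K6"
proof (rule inj_onI)
  fix x y assume xy: "x \<in> K6" "y \<in> K6" "drawing x = drawing y"
  obtain i j where ij: "lv i < lv j" "x \<in> K6_edge i j"
    using K6_cases[OF xy(1)] .
  obtain k l where kl: "lv k < lv l" "y \<in> K6_edge k l"
    using K6_cases[OF xy(2)] .
  have "i \<noteq> j" "k \<noteq> l"
    using ij kl by auto
  then have eq: "hgt x = hgt y" "polyline N (W i j) (hgt x) = polyline N (W k l) (hgt x)"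
    using xy(3) ij kl by (auto simp: drawing_edge[of i j] drawing_edge[of k l])
  show "x = y"
  proof (cases "(i, j) = (k, l)")
    case True
    then show ?thesis
      using edge_point_hgt(1)[OF ij] edge_point_hgt(1)[OF kl] eq(1) by (metis prod.inject)
  next
    case False
    obtain m where m: "m \<in> {i, j} \<inter> {k, l}" "hgt x = real (lv m)"
      using strands_meet[OF False ij(1) kl(1), of "hgt x"] edge_point_hgt[OF ij] edge_point_hgt[OF kl] eq by auto
    have "x = axis m 1"
      using m edge_point_hgt(1)[OF ij] \<open>i \<noteq> j\<close> by auto
    moreover have "y = axis m 1"
      using m eq edge_point_hgt(1)[OF kl] \<open>k \<noteq> l\<close> by auto
    ultimately show ?thesis
      by simp
  qed
qed

lemma continuous_on_drawing: "continuous_on K6 drawing"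
proof -
  have "K6 = (\<Union>(i, j)\<in>{(i, j). i \<noteq> j}. K6_edge i j)"
  proof
    show "K6 \<subseteq> (\<Union>(i, j)\<in>{(i, j). i \<noteq> j}. K6_edge i j)"
    proof
      fix x assume "x \<in> K6"
      then obtain i j where "lv i < lv j" "x \<in> K6_edge i j"
        by (rule K6_cases)
      then show "x \<in> (\<Union>(i, j)\<in>{(i, j). i \<noteq> j}. K6_edge i j)"
        by (intro UN_I[of "(i, j)"]) auto
    qed
  qed (auto simp: K6_def)
  moreover have "continuous_on (\<Union>(i, j)\<in>{(i, j). i \<noteq> j}. K6_edge i j) drawing"
  proof (rule continuous_on_closed_Union)
    fix p :: "6 \<times> 6" assume "p \<in> {(i, j). i \<noteq> j}"
    then obtain i j where p: "p = (i, j)" "i \<noteq> j"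
      by auto
    have "continuous_on (K6_edge i j) (\<lambda>x. pt (hgt x) (polyline N (W i j) (hgt x)))"
      by (intro continuous_intros continuous_on_hgt)
    then show "continuous_on (case p of (i, j) \<Rightarrow> K6_edge i j) drawing"
      using p drawing_edge by (simp cong: continuous_on_cong)
  qed (auto simp: K6_edge_def)
  ultimately show ?thesis
    by simp
qed

text \<open>A continuous injection from a compact space into a Hausdorff space is closed.\<close>

lemma embedding_map_drawing: "embedding_map (top_of_set K6) euclidean drawing"
proof (rule injective_closed_imp_embedding_map)
  show cont: "continuous_map (top_of_set K6) euclidean drawing"
    using continuous_on_drawing by simp
  have "compact K6"
    by (auto simp: K6_def K6_edge_def intro!: compact_UN)
  then show "closed_map (top_of_set K6) euclidean drawing"
    using cont by (intro T1_Spaces.continuous_imp_closed_map) (auto simp: compact_space_subtopology)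
  show "inj_on drawing (topspace (top_of_set K6))"
    using inj_on_drawing by simp
qed

text \<open>The edges are cut at the integer heights, the only places where their images can
  bend.\<close>

lemma piecewise_linear_drawing: "piecewise_linear_on K6 drawing"
proof (rule piecewise_linear_on_segments)
  define I where "I = {(i, j, n). lv i \<le> n \<and> n < lv j}"
  define E where "E = (\<lambda>(i, j, n). (edge_point i j (real n), edge_point i j (real (Suc n)))) ` I"
  have "I \<subseteq> UNIV \<times> UNIV \<times> {..N}"
    using lv_le by (auto simp: I_def intro: le_trans less_imp_le)
  then have "finite I"
    by (rule finite_subset) (simp add: finite_cartesian_product)
  then show "finite E"
    by (simp add: E_def)
  have seg: "closed_segment (edge_point i j (real n)) (edge_point i j (real (Suc n))) =
      {x \<in> K6_edge i j. real n \<le> hgt x \<and> hgt x \<le> real (Suc n)}" if "(i, j, n) \<in> I" for i j n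
  proof -
    have ij: "lv i < lv j" "i \<noteq> j" "lv i \<le> n" "Suc n \<le> lv j"
      using that by (auto simp: I_def)
    have "closed_segment (edge_point i j (real n)) (edge_point i j (real (Suc n))) = edge_point i j ` {real n..real (Suc n)}"
      using ij by (intro closed_segment_edge_point) auto
    also have "\<dots> = {x \<in> K6_edge i j. real n \<le> hgt x \<and> hgt x \<le> real (Suc n)}"
      using ij unfolding K6_edge_eq_image[OF ij(1)] by force
    finally show ?thesis .
  qed
  have E: "\<exists>i j n. (i, j, n) \<in> I \<and> a = edge_point i j (real n) \<and> b = edge_point i j (real (Suc n))"
    if "(a, b) \<in> E" for a b
    using that unfolding E_def by auto
  show "a \<noteq> b" if "(a, b) \<in> E" for a b
  proof -
    obtain i j n where "(i, j, n) \<in> I" "a = edge_point i j (real n)" "b = edge_point i j (real (Suc n))"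
      using E[OF \<open>(a, b) \<in> E\<close>] by blast
    then have "hgt a \<noteq> hgt b"
      using lv_less_imp_neq[of i j] by (auto simp: I_def)
    then show ?thesis
      by auto
  qed
  \<comment> \<open>Vertices have integer heights, so a vertex in a piece is one of its two ends.
    Pieces of different edges meet only in vertices.\<close>
  have vertex: "edge_point i j (hgt x) \<in> {edge_point i j (real n), edge_point i j (real (Suc n))}"
    if "x = axis m 1" "real n \<le> hgt x" "hgt x \<le> real (Suc n)" for i j n x m
  proof -
    have "lv m = n \<or> lv m = Suc n"
      using that by auto
    then show ?thesis
      using that by auto
  qed
  show "{a, b} = {c, d} \<or> x \<in> {a, b} \<inter> {c, d}"
    if abE: "(a, b) \<in> E" and cdE: "(c, d) \<in> E"
      and x_in: "x \<in> closed_segment a b" "x \<in> closed_segment c d" for a b c d x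
  proof -
    obtain i j n where ab: "(i, j, n) \<in> I" "a = edge_point i j (real n)" "b = edge_point i j (real (Suc n))"
      using E[OF abE] by blast
    obtain k l m where cd: "(k, l, m) \<in> I" "c = edge_point k l (real m)" "d = edge_point k l (real (Suc m))"
      using E[OF cdE] by blast
    have lt: "lv i < lv j" "lv k < lv l" and ne: "i \<noteq> j" "k \<noteq> l"
      using ab(1) cd(1) by (auto simp: I_def)
    have x: "x \<in> K6_edge i j" "real n \<le> hgt x" "hgt x \<le> real (Suc n)"
      "x \<in> K6_edge k l" "real m \<le> hgt x" "hgt x \<le> real (Suc m)"
      using x_in unfolding ab(2,3) cd(2,3) seg[OF ab(1)] seg[OF cd(1)] by auto
    note xe = edge_point_hgt(1)[OF lt(1) x(1)] edge_point_hgt(1)[OF lt(2) x(4)]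
    show ?thesis
    proof (cases "(i, j) = (k, l)")
      case True
      have "n = m \<or> (m = Suc n \<and> hgt x = real m) \<or> (n = Suc m \<and> hgt x = real n)"
        using x by linarith
      then show ?thesis
        using xe True unfolding ab(2,3) cd(2,3) by auto
    next
      case False
      then have "{i, j} \<noteq> {k, l}"
        using lt by (auto simp: doubleton_eq_iff)
      then obtain p where "x = axis p 1"
        using K6_edges_meet[OF ne(1,2) _ x(1,4)] by blast
      then show ?thesis
        using vertex[of x p n i j] vertex[of x p m k l] x xe unfolding ab(2,3) cd(2,3) by auto
    qed
  qed
  show "K6 = (\<Union>(a, b)\<in>E. closed_segment a b)"
  proof (intro equalityI subsetI)
    fix x assume "x \<in> K6"
    then obtain i j where ij: "lv i < lv j" "x \<in> K6_edge i j"
      by (rule K6_cases)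
    obtain n where n: "lv i \<le> n" "n < lv j" "real n \<le> hgt x" "hgt x \<le> real n + 1"
      using slab_cases edge_point_hgt(2,3)[OF ij] ij(1) by metis
    then have "(i, j, n) \<in> I"
      by (simp add: I_def)
    moreover from this have "x \<in> closed_segment (edge_point i j (real n)) (edge_point i j (real (Suc n)))"
      using seg n ij by auto
    ultimately show "x \<in> (\<Union>(a, b)\<in>E. closed_segment a b)"
      unfolding E_def by force
  next
    fix x assume "x \<in> (\<Union>(a, b)\<in>E. closed_segment a b)"
    then obtain a b where "(a, b) \<in> E" "x \<in> closed_segment a b"
      by auto
    then obtain i j n where "(i, j, n) \<in> I" "x \<in> closed_segment (edge_point i j (real n)) (edge_point i j (real (Suc n)))"
      using E by metis
    then show "x \<in> K6"
      using seg by (auto simp: K6_def)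
  qed
  show "\<exists>h c. linear h \<and> (\<forall>x\<in>closed_segment a b. drawing x = h x + c)" if abE: "(a, b) \<in> E" for a b
  proof -
    obtain i j n where ab: "(i, j, n) \<in> I" "a = edge_point i j (real n)" "b = edge_point i j (real (Suc n))"
      using E[OF abE] by blast
    define d where "d = W i j (Suc n) - W i j n"
    have "i \<noteq> j" "n < N"
      using ab(1) lv_le[of j] by (auto simp: I_def)
    \<comment> \<open>Since \<open>hgt\<close> is linear on all of the ambient space, the slab
      formula is a linear map plus a constant.\<close>
    then have "\<forall>x\<in>closed_segment a b. drawing x = hgt x *\<^sub>R pt 1 d + pt 0 (W i j n - real n *\<^sub>R d)"
      unfolding ab(2,3) seg[OF ab(1)]
      by (auto simp: drawing_edge[of i j] polyline_slab[of n] d_def pt_scaleR pt_add algebra_simps)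
    moreover have "linear (\<lambda>x. hgt x *\<^sub>R pt 1 d)"
      using linear_add[OF linear_hgt] linear_scale[OF linear_hgt]
      by (intro linearI) (simp_all add: algebra_simps)
    ultimately show ?thesis
      by blast
  qed
qed

lemma PL_embedding_drawing: "PL_embedding_K6 drawing"
  by (simp add: PL_embedding_K6_def piecewise_linear_drawing embedding_map_drawing)

section \<open>Triangles as bigons: unknottedness and linking numbers\<close>

definition triangle :: "6 \<Rightarrow> 6 \<Rightarrow> 6 \<Rightarrow> (real^6) set" where
  "triangle i j k = K6_edge i j \<union> K6_edge j k \<union> K6_edge k i"

text \<open>For increasing levels, \<open>True\<close> is the way through the middle vertex and
  \<open>False\<close> the long edge.\<close>

definition triangle_strand :: "6 \<Rightarrow> 6 \<Rightarrow> 6 \<Rightarrow> bool \<Rightarrow> nat \<Rightarrow> complex" where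
  "triangle_strand i j k \<sigma> n = (if \<sigma> then if n \<le> lv j then W i j n else W j k n else W i k n)"

lemma three_cycle_cases:
  assumes "A \<in> K6_three_cycles"
  obtains i j k where "lv i < lv j" "lv j < lv k" "A = triangle i j k"
proof -
  obtain a b c where abc: "A = triangle a b c" "a \<noteq> b" "b \<noteq> c" "c \<noteq> a"
    using assms by (auto simp: K6_three_cycles_def triangle_def)
  have rot: "triangle a b c = triangle b c a" for a b c
    by (auto simp: triangle_def)
  have flip: "triangle a b c = triangle c b a" for a b c
    using K6_edge_commute by (auto simp: triangle_def)
  have "lv a \<noteq> lv b" "lv b \<noteq> lv c" "lv c \<noteq> lv a"
    using abc by auto
  then consider "lv a < lv b" "lv b < lv c" | "lv b < lv c" "lv c < lv a" | "lv c < lv a" "lv a < lv b"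
    | "lv c < lv b" "lv b < lv a" | "lv b < lv a" "lv a < lv c" | "lv a < lv c" "lv c < lv b"
    by linarith
  then show thesis
    by cases (use that abc(1) rot flip in metis)+
qed

lemma triangle_mem: "lv i < lv j \<Longrightarrow> lv j < lv k \<Longrightarrow> triangle i j k \<in> K6_three_cycles"
  unfolding K6_three_cycles_def triangle_def by (rule CollectI) (metis less_asym less_irrefl less_trans)

context
  fixes i j k
  assumes ij: "lv i < lv j" and jk: "lv j < lv k"
begin

lemma triangle_strand_upper:
  assumes "lv j \<le> n"
  shows "triangle_strand i j k True n = W j k n"
  using assms lv_less_imp_neq[OF ij] lv_less_imp_neq[OF jk] W_lv'[of i j] W_lv[of j k] by (auto simp: triangle_strand_def)

lemma polyline_triangle_strand:
  "real (lv i) \<le> h \<Longrightarrow> h \<le> real (lv j) \<Longrightarrow> polyline N (triangle_strand i j k True) h = polyline N (W i j) h"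
  "real (lv j) \<le> h \<Longrightarrow> h \<le> real (lv k) \<Longrightarrow> polyline N (triangle_strand i j k True) h = polyline N (W j k) h"
  "triangle_strand i j k False = W i k"
proof -
  show "polyline N (triangle_strand i j k True) h = polyline N (W i j) h" if "real (lv i) \<le> h" "h \<le> real (lv j)"
    by (rule polyline_cong[OF _ that ij lv_le]) (simp add: triangle_strand_def)
  show "polyline N (triangle_strand i j k True) h = polyline N (W j k) h" if "real (lv j) \<le> h" "h \<le> real (lv k)"
    by (rule polyline_cong[OF triangle_strand_upper that jk lv_le])
  show "triangle_strand i j k False = W i k"
    by (simp add: triangle_strand_def fun_eq_iff)
qed

lemma drawing_image_triangle:
  "drawing ` triangle i j k =
     strand N (triangle_strand i j k True) (lv i) (lv k) \<union> strand N (triangle_strand i j k False) (lv i) (lv k)"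
proof -
  have ivl: "{real (lv i)..real (lv k)} = {real (lv i)..real (lv j)} \<union> {real (lv j)..real (lv k)}"
    using ij jk by auto
  have "strand N (triangle_strand i j k True) (lv i) (lv k) = strand N (W i j) (lv i) (lv j) \<union> strand N (W j k) (lv j) (lv k)"
    unfolding strand_def ivl image_Un
    by (intro arg_cong2[of _ _ _ _ "(\<union>)"] image_cong refl) (auto simp: polyline_triangle_strand)
  then show ?thesis
    using ij jk by (simp add: triangle_def image_Un drawing_image_edge K6_edge_commute[of k i] polyline_triangle_strand(3))
qed

lemma triangle_bigon_aux:
  assumes h: "real (lv i) < h" "h < real (lv k)"
  shows "polyline N (triangle_strand i j k True) h \<noteq> polyline N (triangle_strand i j k False) h"
proof
  assume eq: "polyline N (triangle_strand i j k True) h = polyline N (triangle_strand i j k False) h"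
  have ik: "lv i < lv k" and ne: "j \<noteq> k" "i \<noteq> j"
    using ij jk by auto
  show False
  proof (cases "h \<le> real (lv j)")
    case True
    then have "\<exists>m\<in>{i, j} \<inter> {i, k}. h = real (lv m)"
      using ij ik h ne jk eq by (intro strands_meet) (auto simp: polyline_triangle_strand)
    then show False
      using h ne by auto
  next
    case False
    then have "\<exists>m\<in>{j, k} \<inter> {i, k}. h = real (lv m)"
      using jk ik h ne eq by (intro strands_meet) (auto simp: polyline_triangle_strand)
    then show False
      using h ne by auto
  qed
qed

lemma triangle_ends:
  "triangle_strand i j k True (lv i) = triangle_strand i j k False (lv i)"
  "triangle_strand i j k True (lv k) = triangle_strand i j k False (lv k)"
proof -
  have "i \<noteq> j" "i \<noteq> k" "j \<noteq> k"
    using ij jk by auto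
  then show "triangle_strand i j k True (lv i) = triangle_strand i j k False (lv i)"
    "triangle_strand i j k True (lv k) = triangle_strand i j k False (lv k)"
    using ij jk by (auto simp: triangle_strand_def W_lv W_lv')
qed

lemma bigon_triangle: "bigon N (lv i) (lv k) (triangle_strand i j k)"
  using ij jk lv_le[of k] triangle_ends triangle_bigon_aux by unfold_locales auto

text \<open>Three distinct integer levels give \<open>lv i + 2 <= lv k\<close>, the room that
  \<open>unknotted_strands\<close> asks for.\<close>

lemma unknotted_triangle: "unknotted (drawing ` triangle i j k)"
  unfolding drawing_image_triangle
  by (rule unknotted_strands) (use ij jk lv_le triangle_ends triangle_bigon_aux in auto)

end

lemma triangles_disjoint:
  assumes ijk: "lv i < lv j" "lv j < lv k" and ijk': "lv i' < lv j'" "lv j' < lv k'"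
    and disjoint: "{i, j, k} \<inter> {i', j', k'} = {}"
  shows "triangle i j k \<inter> triangle i' j' k' = {}"
proof -
  have ne: "i \<noteq> j" "j \<noteq> k" "k \<noteq> i" "i' \<noteq> j'" "j' \<noteq> k'" "k' \<noteq> i'"
    using ijk ijk' by auto
  have "K6_edge a b \<inter> K6_edge c d = {}" if "a \<noteq> b" "c \<noteq> d" "{a, b} \<inter> {c, d} = {}" for a b c d
  proof -
    have "{a, b} \<noteq> {c, d}"
      using that by auto
    then have False if "x \<in> K6_edge a b" "x \<in> K6_edge c d" for x
      by (rule K6_edges_meet[OF \<open>a \<noteq> b\<close> \<open>c \<noteq> d\<close> _ that]) (use \<open>{a, b} \<inter> {c, d} = {}\<close> in blast)
    then show ?thesis
      by blast
  qed
  then show "triangle i j k \<inter> triangle i' j' k' = {}"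
    using ne disjoint unfolding triangle_def by (simp add: Int_Un_distrib Int_Un_distrib2)
qed

text \<open>Edges of the two triangles have no common vertex, so \<open>level\<close> forbids equal
  real parts: the projection is generic.\<close>

lemma linking_number_triangles:
  assumes ijk: "lv i < lv j" "lv j < lv k" and ijk': "lv i' < lv j'" "lv j' < lv k'"
    and disjoint: "{i, j, k} \<inter> {i', j', k'} = {}"
    and sum: "2 * real_of_int z = crossing_sum (max (lv i) (lv i')) (min (lv k) (lv k'))
      (triangle_strand i j k) (triangle_strand i' j' k')"
  shows "has_abs_linking_number (drawing ` triangle i j k) (drawing ` triangle i' j' k') \<bar>z\<bar>"
proof -
  interpret P: bigon N "lv i" "lv k" "triangle_strand i j k"
    by (rule bigon_triangle) fact+
  interpret Q: bigon N "lv i'" "lv k'" "triangle_strand i' j' k'"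
    by (rule bigon_triangle) fact+
  have strand_cases: "\<exists>a b. {a, b} \<subseteq> {i, j, k} \<and> lv a < lv b \<and> lv a \<le> n \<and> n \<le> lv b \<and> triangle_strand i j k \<sigma> n = W a b n"
    if "lv i < lv j" "lv j < lv k" "lv i \<le> n" "n \<le> lv k" for i j k \<sigma> n
  proof -
    consider "\<sigma>" "n \<le> lv j" | "\<sigma>" "lv j < n" | "\<not> \<sigma>"
      by linarith
    then show ?thesis
    proof cases
      case 1
      then show ?thesis
        using that by (intro exI[of _ i] exI[of _ j]) (auto simp: triangle_strand_def)
    next
      case 2
      then show ?thesis
        using that by (intro exI[of _ j] exI[of _ k]) (auto simp: triangle_strand_def)
    next
      case 3
      then show ?thesis
        using that by (intro exI[of _ i] exI[of _ k]) (auto simp: triangle_strand_def)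
    qed
  qed
  have img: "path_image P.loop = drawing ` triangle i j k" "path_image Q.loop = drawing ` triangle i' j' k'"
    by (simp_all add: P.path_image_loop Q.path_image_loop drawing_image_triangle ijk ijk')
  have "has_linking_number P.loop Q.loop z"
  proof (rule has_linking_number_bigons)
    show "bigon N (lv i) (lv k) (triangle_strand i j k)" "bigon N (lv i') (lv k') (triangle_strand i' j' k')"
      by unfold_locales
    show "Re (triangle_strand i j k \<sigma> n) \<noteq> Re (triangle_strand i' j' k' \<tau> n)"
      if n: "max (lv i) (lv i') \<le> n" "n \<le> min (lv k) (lv k')" for \<sigma> \<tau> n
    proof
      assume eq: "Re (triangle_strand i j k \<sigma> n) = Re (triangle_strand i' j' k' \<tau> n)"
      obtain a b where ab: "{a, b} \<subseteq> {i, j, k}" "lv a < lv b" "lv a \<le> n" "n \<le> lv b" "triangle_strand i j k \<sigma> n = W a b n"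
        using strand_cases[OF ijk, of n \<sigma>] n by auto
      obtain c d where cd: "{c, d} \<subseteq> {i', j', k'}" "lv c < lv d" "lv c \<le> n" "n \<le> lv d" "triangle_strand i' j' k' \<tau> n = W c d n"
        using strand_cases[OF ijk', of n \<tau>] n by auto
      have "(a, b) \<noteq> (c, d)" "{a, b} \<inter> {c, d} = {}"
        using ab(1) cd(1) disjoint by blast+
      then show False
        using level[of a b c d n] ab cd eq by auto
    qed
    show "path_image P.loop \<inter> path_image Q.loop = {}"
    proof -
      have sub: "triangle a b c \<subseteq> K6" for a b c
        by (auto simp: triangle_def K6_def)
      have "triangle i j k \<inter> triangle i' j' k' = {}"
        by (rule triangles_disjoint) fact+
      then show ?thesis
        unfolding img using inj_on_image_Int[OF inj_on_drawing sub sub] by (metis image_empty)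
    qed
  qed (rule sum)
  then show ?thesis
    unfolding has_abs_linking_number_def using img by blast
qed

end

section \<open>The twisted drawing\<close>

text \<open>The coordinates were found by a computer search. Apart from the spins, every edge stays at its home
  position strictly between the levels of its ends; edges between consecutive levels have no such
  position, and \<open>home\<close> is irrelevant for them. With every turn, the edge 03 winds once around 24,
  05 around 14, and 13 around 25. In K6, each of these three pairs lies in two of the ten pairs of
  disjoint triangles; together they join 013|245 to two other pairs, and these two to each other. The
  spin directions make the contributions cancel except at 013|245, where they add up to 2.\<close>

definition vertex_pos :: "nat \<Rightarrow> int \<times> int" where
  "vertex_pos p = [(8, 0), (10, 0), (18, 1), (9, 1), (11, 0), (12, 0)] ! p"

definition home :: "nat \<Rightarrow> nat \<Rightarrow> int \<times> int" where
  "home p q = (case map_of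
     [((0, 2), (19, 0)), ((0, 3), (2, 0)), ((0, 4), (1, 0)), ((0, 5), (5, -1)), ((1, 3), (13, 0)), ((1, 4), (6, -1)),
      ((1, 5), (16, 0)), ((2, 3), (17, 0)), ((2, 4), (3, 0)), ((2, 5), (14, 0)), ((3, 5), (0, 0))] (p, q) of
     Some w \<Rightarrow> w | None \<Rightarrow> (0, 0))"

definition spin :: "nat \<Rightarrow> nat \<Rightarrow> nat \<Rightarrow> int" where
  "spin p q s =
     (if s \<noteq> 4 \<and> s \<noteq> 5 then 0
      else if (p, q) = (0, 3) \<or> (p, q) = (1, 3) then if s = 4 then 1 else -1
      else if (p, q) = (0, 5) then if s = 4 then -1 else 1
      else 0)"

text \<open>The stages 0, 1, 2 and 6, 7, 8 are the levels of the vertices. Stages 3, 4, 5 make up one turn and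
  are repeated, so that a single finite check covers all numbers of turns.\<close>

definition stage :: "nat \<Rightarrow> nat" where
  "stage p = (if p < 3 then p else p + 3)"

text \<open>A spinning edge has its home one unit to the left of its partner. From
  \<open>(x, y)\<close> it goes to \<open>(x + 2, y + e)\<close>, then \<open>(x + 2, y - e)\<close>
  and back, with \<open>e = 1\<close> or \<open>e = -1\<close>, and so encircles the partner at
  \<open>(x + 1, y)\<close> once; the sign \<open>e\<close> is the direction.\<close>

definition edge_pos :: "nat \<Rightarrow> nat \<Rightarrow> nat \<Rightarrow> int \<times> int" where
  "edge_pos p q s =
     (if s = stage p then vertex_pos p else if s = stage q then vertex_pos q
      else (fst (home p q) + 2 * \<bar>spin p q s\<bar>, snd (home p q) + spin p q s))"

text \<open>\<open>(5, 3)\<close> completes a turn; from stage 3 either another turn starts or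
  \<open>(3, 6)\<close> leads on to vertex 3.\<close>

definition steps :: "(nat \<times> nat) list" where
  "steps = [(0, 1), (1, 2), (2, 3), (3, 4), (4, 5), (5, 3), (3, 6), (6, 7), (7, 8)]"

definition edges :: "(nat \<times> nat) list" where
  "edges = [(p, q). p \<leftarrow> [0..<6], q \<leftarrow> [Suc p..<6]]"


text \<open>For a slab, take its two stages; for a level, the same stage twice. This is right even
  for the backward step from 5 to 3, as no vertex has stage 3, 4 or 5.\<close>

definition live :: "nat \<Rightarrow> nat \<Rightarrow> (nat \<times> nat) list" where
  "live s s' = filter (\<lambda>(p, q). if stage p \<le> s then s' \<le> stage q else False) edges"

text \<open>The assumption \<open>level\<close> of \<open>monotone_drawing\<close> on the nine
  stages; \<open>edge_pos_slab\<close> does the same for \<open>slab\<close> on the nine steps.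
  Positions depend on a height only through its stage, so this settles every
  \<open>z\<close>.\<close>

lemma edge_pos_level:
  "list_all (\<lambda>s. list_all (\<lambda>(p, q). list_all (\<lambda>(p', q').
     if fst (edge_pos p q s) = fst (edge_pos p' q' s) then
       if (p, q) = (p', q') then True else
       if s = stage p then p = p' \<or> p = q' else if s = stage q then q = p' \<or> q = q' else False
     else True) (live s s)) (live s s)) [0..<9]"
  by code_simp

definition det2 :: "int \<times> int \<Rightarrow> int \<times> int \<Rightarrow> int" where
  "det2 w w' = fst w * snd w' - snd w * fst w'"

definition minus2 :: "int \<times> int \<Rightarrow> int \<times> int \<Rightarrow> int \<times> int" where
  "minus2 w w' = (fst w - fst w', snd w - snd w')"

lemma edge_pos_slab:
  "list_all (\<lambda>(s, s'). list_all (\<lambda>(p, q). list_all (\<lambda>(p', q').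
     (let w = minus2 (edge_pos p q s) (edge_pos p' q' s); w' = minus2 (edge_pos p q s') (edge_pos p' q' s')
      in if fst w * fst w' < 0 then det2 w w' \<noteq> 0 else True)) (live s s')) (live s s')) steps"
  by code_simp

section \<open>Integer crossing signs of pairs of triangles\<close>

definition sign2 :: "int \<times> int \<Rightarrow> int \<times> int \<Rightarrow> int" where
  "sign2 w w' = (if fst w * fst w' < 0 then sgn (det2 w w') else 0)"

definition triangle_pos :: "nat \<times> nat \<times> nat \<Rightarrow> bool \<Rightarrow> nat \<Rightarrow> int \<times> int" where
  "triangle_pos t \<sigma> s = (case t of (p, q, r) \<Rightarrow>
     if \<sigma> then if s \<le> stage q then edge_pos p q s else edge_pos q r s else edge_pos p r s)"

definition pair_sign :: "nat \<times> nat \<times> nat \<Rightarrow> nat \<times> nat \<times> nat \<Rightarrow> nat \<Rightarrow> nat \<Rightarrow> bool \<Rightarrow> bool \<Rightarrow> int" where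
  "pair_sign t t' s s' \<sigma> \<tau> = sign2 (minus2 (triangle_pos t \<sigma> s) (triangle_pos t' \<tau> s))
     (minus2 (triangle_pos t \<sigma> s') (triangle_pos t' \<tau> s'))"

definition step_sum :: "nat \<times> nat \<times> nat \<Rightarrow> nat \<times> nat \<times> nat \<Rightarrow> nat \<Rightarrow> nat \<Rightarrow> int" where
  "step_sum t t' s s' =
     (if stage (fst t) \<le> s \<and> stage (fst t') \<le> s \<and> s' \<le> stage (snd (snd t)) \<and> s' \<le> stage (snd (snd t'))
      then pair_sign t t' s s' True True - pair_sign t t' s s' True False
         - pair_sign t t' s s' False True + pair_sign t t' s s' False False
      else 0)"

definition triples :: "(nat \<times> nat \<times> nat) list" where
  "triples = [(p, q, r). p \<leftarrow> [0..<6], q \<leftarrow> [Suc p..<6], r \<leftarrow> [Suc q..<6]]"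

definition disjoint_triples :: "((nat \<times> nat \<times> nat) \<times> nat \<times> nat \<times> nat) list" where
  "disjoint_triples = filter (\<lambda>((p, q, r), p', q', r'). list_all (\<lambda>v. v \<notin> set [p', q', r']) [p, q, r]) (List.product triples triples)"

text \<open>The first component is the crossing sum without turns, along the stages 0, 1, 2, 3, 6,
  7, 8; the second is the gain per turn. Halved, they give linking number 1 and gain 2 for 013|245,
  which appears in both orders, and 0 for all other pairs.\<close>

lemma step_sums:
  "list_all (\<lambda>(t, t').
     (let H = step_sum t t' in
      (H 0 1 + H 1 2 + H 2 3 + H 3 6 + H 6 7 + H 7 8, H 3 4 + H 4 5 + H 5 3) =
      (if t = (0, 1, 3) \<or> t = (2, 4, 5) then (2, 4) else (0, 0))))
     disjoint_triples"
  by code_simp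

section \<open>Unrolling the stages into \<open>3 * z + 6\<close> slabs\<close>

definition phase :: "nat \<Rightarrow> nat \<Rightarrow> nat" where
  "phase z n = (if n < 3 then n else if n \<le> 3 * z + 3 then 3 + n mod 3 else n - 3 * z + 2)"

text \<open>Between vertices 2 and 3 there are \<open>3 * z + 1\<close> further levels: one at stage
  3, then three for each turn.\<close>

definition vertex_level :: "nat \<Rightarrow> nat \<Rightarrow> nat" where
  "vertex_level z p = (if p < 3 then p else p + 3 * z + 1)"

text \<open>\<open>phase\<close> is not monotone, since it falls from 5 to 3, but comparisons with
  vertices stay faithful: stages 3, 4 and 5 all lie between those of vertices 2 and 3.\<close>

lemma phase_le_stage_iff: "p < 6 \<Longrightarrow> n \<le> 3 * z + 6 \<Longrightarrow> phase z n \<le> stage p \<longleftrightarrow> n \<le> vertex_level z p"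
  and stage_le_phase_iff: "p < 6 \<Longrightarrow> n \<le> 3 * z + 6 \<Longrightarrow> stage p \<le> phase z n \<longleftrightarrow> vertex_level z p \<le> n"
  using mod_less_divisor[of 3 n] by (auto simp: phase_def stage_def vertex_level_def)

lemma vertex_level_less_iff: "vertex_level z p < vertex_level z q \<longleftrightarrow> p < q"
  by (auto simp: vertex_level_def)

lemma vertex_level_le: "p < 6 \<Longrightarrow> vertex_level z p \<le> 3 * z + 6"
  by (auto simp: vertex_level_def)

lemma phase_vertex_level: "p < 6 \<Longrightarrow> phase z (vertex_level z p) = stage p"
  using phase_le_stage_iff[of p "vertex_level z p" z] stage_le_phase_iff[of p "vertex_level z p" z] vertex_level_le
  by simp

lemma phase_step:
  assumes "n < 3 * z + 6"
  shows "(phase z n, phase z (Suc n)) \<in> set steps"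
proof -
  consider "n = 0" | "n = 1" | "n = 2" | "3 \<le> n" "n < 3 * z + 3" | "n = 3 * z + 3" | "n = 3 * z + 4" | "n = 3 * z + 5"
    using assms by linarith
  then show ?thesis
  proof cases
    case 4
    have "n mod 3 = 0 \<or> n mod 3 = 1 \<or> n mod 3 = 2"
      by auto
    then show ?thesis
      using 4 by (auto simp: phase_def steps_def mod_Suc)
  qed (auto simp: phase_def steps_def)
qed

lemma sum_lessThan_add: "(\<Sum>n<a + b. g n) = (\<Sum>n<a. g n) + (\<Sum>n<b. g (a + n))" for g :: "nat \<Rightarrow> int"
  by (induction b) (simp_all add: add.assoc)

text \<open>Here the unbounded parameter leaves the computation: three slabs below, \<open>z\<close>
  identical turns of three slabs, three slabs above.\<close>

lemma sum_phase:
  fixes H :: "nat \<Rightarrow> nat \<Rightarrow> int"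
  shows "(\<Sum>n<3 * z + 6. H (phase z n) (phase z (Suc n))) =
    (H 0 1 + H 1 2 + H 2 3 + H 3 6 + H 6 7 + H 7 8) + int z * (H 3 4 + H 4 5 + H 5 3)"
proof -
  define g where "g = (\<lambda>n. H (phase z n) (phase z (Suc n)))"
  \<comment> \<open>\<open>phase\<close> depends on \<open>z\<close>, so the induction counts turns
    \<open>k <= z\<close> with \<open>z\<close> fixed.\<close>
  have "(\<Sum>n<3 * k. g (3 + n)) = int k * (H 3 4 + H 4 5 + H 5 3)" if "k \<le> z" for k
    using that
  proof (induction k)
    case (Suc k)
    have "g (3 + 3 * k) = H 3 4" "g (Suc (3 + 3 * k)) = H 4 5" "g (Suc (Suc (3 + 3 * k))) = H 5 3"
      using Suc.prems by (simp_all add: g_def phase_def mod_Suc)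
    moreover have "(\<Sum>n<3 * Suc k. g (3 + n)) = (\<Sum>n<3 * k. g (3 + n)) +
        (g (3 + 3 * k) + g (Suc (3 + 3 * k)) + g (Suc (Suc (3 + 3 * k))))"
    proof -
      have "3 * Suc k = Suc (Suc (Suc (3 * k)))"
        by simp
      then show ?thesis
        by (simp only: sum.lessThan_Suc add_Suc_right add.assoc)
    qed
    ultimately show ?case
      using Suc by (simp add: algebra_simps)
  qed simp
  moreover have "(\<Sum>n<3 * z + 6. g n) = (\<Sum>n<3. g n) + ((\<Sum>n<3 * z. g (3 + n)) + (\<Sum>n<3. g (3 + (3 * z + n))))"
  proof -
    have "3 * z + 6 = 3 + (3 * z + 3)"
      by simp
    then show ?thesis
      by (simp only: sum_lessThan_add)
  qed
  moreover have three: "(\<Sum>n<3. f n) = f 0 + f 1 + f 2" for f :: "nat \<Rightarrow> int"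
    by (simp add: eval_nat_numeral)
  moreover have "g 0 = H 0 1" "g 1 = H 1 2" "g 2 = H 2 3"
    "g (3 + (3 * z + 0)) = H 3 6" "g (3 + (3 * z + 1)) = H 6 7" "g (3 + (3 * z + 2)) = H 7 8"
    by (simp_all add: g_def phase_def numeral_2_eq_2)
  ultimately have "(\<Sum>n<3 * z + 6. g n) =
      (H 0 1 + H 1 2 + H 2 3 + H 3 6 + H 6 7 + H 7 8) + int z * (H 3 4 + H 4 5 + H 5 3)"
    by (simp only: three)
  then show ?thesis
    by (simp add: g_def)
qed

section \<open>From the integer tables to the drawing of K6\<close>

definition cpx :: "int \<times> int \<Rightarrow> complex" where
  "cpx w = Complex (of_int (fst w)) (of_int (snd w))"

lemma cpx_simps [simp]: "Re (cpx w) = of_int (fst w)" "Im (cpx w) = of_int (snd w)"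
  by (simp_all add: cpx_def)

lemma cpx_diff: "cpx w - cpx w' = cpx (minus2 w w')"
  by (simp add: complex_eq_iff minus2_def)

lemma slab_sign_cpx: "slab_sign (cpx w) (cpx w') = of_int (sign2 w w')"
proof -
  have "real_of_int (fst w) * real_of_int (fst w') < 0 \<longleftrightarrow> fst w * fst w' < 0"
    by (metis of_int_less_0_iff of_int_mult)
  moreover have "sgn (real_of_int (fst w) * real_of_int (snd w') - real_of_int (snd w) * real_of_int (fst w')) =
      real_of_int (sgn (det2 w w'))"
  proof -
    have "sgn (real_of_int x) = real_of_int (sgn x)" for x
      by (simp add: sgn_if)
    then show ?thesis
      unfolding det2_def of_int_mult[symmetric] of_int_diff[symmetric] .
  qed
  ultimately show ?thesis
    by (simp add: slab_sign_def sign2_def)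
qed

lemma exhaust_6: "x = 0 \<or> x = 1 \<or> x = 2 \<or> x = 3 \<or> x = 4 \<or> x = 5" for x :: 6
proof (induct x)
  case (of_int z)
  then have "z = 0 \<or> z = 1 \<or> z = 2 \<or> z = 3 \<or> z = 4 \<or> z = 5"
    by fastforce
  then show ?case
    by auto
qed

definition idx :: "6 \<Rightarrow> nat" where
  "idx x = (if x = 0 then 0 else if x = 1 then 1 else if x = 2 then 2 else if x = 3 then 3 else if x = 4 then 4 else 5)"

lemma idx_numeral [simp]: "idx 0 = 0" "idx 1 = 1" "idx 2 = 2" "idx 3 = 3" "idx 4 = 4" "idx 5 = 5"
  by (simp_all add: idx_def)

lemma idx_less [simp]: "idx x < 6"
  by (auto simp: idx_def)

lemma idx_eq_iff [simp]: "idx x = idx y \<longleftrightarrow> x = y"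
  using exhaust_6[of x] exhaust_6[of y] by (elim disjE) simp_all

definition K6_level :: "nat \<Rightarrow> 6 \<Rightarrow> nat" where
  "K6_level z i = vertex_level z (idx i)"

text \<open>The tables list an edge with its lower vertex first; \<open>min\<close> and
  \<open>max\<close> make the strand symmetric in its ends.\<close>

definition K6_strand :: "nat \<Rightarrow> 6 \<Rightarrow> 6 \<Rightarrow> nat \<Rightarrow> complex" where
  "K6_strand z i j n = cpx (edge_pos (min (idx i) (idx j)) (max (idx i) (idx j)) (phase z n))"

lemma K6_level_less_iff: "K6_level z i < K6_level z j \<longleftrightarrow> idx i < idx j"
  by (simp add: K6_level_def vertex_level_less_iff)

lemma K6_strand_less: "K6_level z i < K6_level z j \<Longrightarrow> K6_strand z i j n = cpx (edge_pos (idx i) (idx j) (phase z n))"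
  by (simp add: K6_level_less_iff K6_strand_def)

lemma mem_edges: "(p, q) \<in> set edges \<longleftrightarrow> p < q \<and> q < 6"
  by (force simp: edges_def)

lemma mem_live: "(p, q) \<in> set (live s s') \<longleftrightarrow> p < q \<and> q < 6 \<and> stage p \<le> s \<and> s' \<le> stage q"
  by (auto simp: live_def mem_edges)

lemma mem_live_phase:
  assumes "n \<le> n'" "K6_level z i \<le> n" "n' \<le> K6_level z j" "K6_level z i < K6_level z j"
  shows "(idx i, idx j) \<in> set (live (phase z n) (phase z n'))"
proof -
  have "K6_level z j \<le> 3 * z + 6"
    unfolding K6_level_def by (intro vertex_level_le idx_less)
  then show ?thesis
    using assms stage_le_phase_iff[of "idx i" n z] phase_le_stage_iff[of "idx j" n' z]
    by (auto simp: mem_live K6_level_less_iff K6_level_def[symmetric])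
qed

lemma monotone_drawing_K6:
  "monotone_drawing (3 * z + 6) (K6_level z) (\<lambda>i. cpx (vertex_pos (idx i))) (K6_strand z)"
proof
  show "inj (K6_level z)"
    by (rule injI) (metis K6_level_less_iff idx_eq_iff nat_neq_iff)
  show level_le: "K6_level z i \<le> 3 * z + 6" for i
    unfolding K6_level_def by (intro vertex_level_le idx_less)
  show "K6_strand z i j = K6_strand z j i" for i j
    by (simp add: K6_strand_def fun_eq_iff min.commute max.commute)
  show "K6_strand z i j (K6_level z i) = cpx (vertex_pos (idx i))" if "i \<noteq> j" for i j
  proof -
    have "phase z (K6_level z i) = stage (idx i)"
      by (simp add: K6_level_def phase_vertex_level)
    moreover have "idx i \<noteq> idx j"
      using that by simp
    ultimately show ?thesis
      by (auto simp: K6_strand_def edge_pos_def min_def max_def stage_def split: if_splits)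
  qed
  fix i j k l :: 6 and n :: nat
  assume ne: "(i, j) \<noteq> (k, l)"
  have idx_ne: "(idx i, idx j) \<noteq> (idx k, idx l)"
    using ne by simp
  {
    assume lt: "K6_level z i < K6_level z j" "K6_level z k < K6_level z l"
      and n: "K6_level z i \<le> n" "n \<le> K6_level z j" "K6_level z k \<le> n" "n \<le> K6_level z l"
      and eq: "Re (K6_strand z i j n) = Re (K6_strand z k l n)"
    define s where "s = phase z n"
    have nN: "n \<le> 3 * z + 6"
      using n(2) level_le le_trans by blast
    have "s \<in> set [0..<9]"
      using phase_le_stage_iff[of 5 n z] nN by (simp add: vertex_level_def s_def stage_def)
    moreover have live: "(idx i, idx j) \<in> set (live s s)" "(idx k, idx l) \<in> set (live s s)"
      using mem_live_phase n lt by (auto simp: s_def)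
    moreover have "fst (edge_pos (idx i) (idx j) s) = fst (edge_pos (idx k) (idx l) s)"
      using eq lt by (simp add: K6_strand_less s_def)
    ultimately consider "s = stage (idx i)" "idx i = idx k \<or> idx i = idx l"
      | "s = stage (idx j)" "idx j = idx k \<or> idx j = idx l"
      using edge_pos_level idx_ne unfolding list_all_iff by (fastforce split: if_splits)
    \<comment> \<open>Unlike stages 3, 4 and 5, the stage of a vertex occurs at one level
      only.\<close>
    moreover have "n = K6_level z m" if "s = stage (idx m)" for m
      using that phase_le_stage_iff[of "idx m" n z] stage_le_phase_iff[of "idx m" n z] nN
      by (simp add: s_def K6_level_def)
    ultimately show "\<exists>m\<in>{i, j} \<inter> {k, l}. n = K6_level z m"
      by cases auto
  }
  {
    assume n: "K6_level z i \<le> n" "n < K6_level z j" "K6_level z k \<le> n" "n < K6_level z l"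
      and neg: "Re (K6_strand z i j n - K6_strand z k l n) * Re (K6_strand z i j (Suc n) - K6_strand z k l (Suc n)) < 0"
    define s s' where "s = phase z n" and "s' = phase z (Suc n)"
    define w where "w = (\<lambda>s. minus2 (edge_pos (idx i) (idx j) s) (edge_pos (idx k) (idx l) s))"
    have "n < 3 * z + 6"
      using n(2) level_le less_le_trans by blast
    then have "(s, s') \<in> set steps"
      by (simp add: s_def s'_def phase_step)
    moreover have "(idx i, idx j) \<in> set (live s s')" "(idx k, idx l) \<in> set (live s s')"
      using mem_live_phase[of n "Suc n"] n by (auto simp: s_def s'_def)
    ultimately have *: "fst (w s) * fst (w s') < 0 \<Longrightarrow> det2 (w s) (w s') \<noteq> 0"
      using edge_pos_slab unfolding list_all_iff Let_def w_def by (fastforce split: if_splits)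
    have "K6_strand z i j n - K6_strand z k l n = cpx (w s)"
      "K6_strand z i j (Suc n) - K6_strand z k l (Suc n) = cpx (w s')"
      using n by (simp_all add: K6_strand_less cpx_diff w_def s_def s'_def)
    moreover have "real_of_int (fst (w s)) * real_of_int (fst (w s')) < 0 \<longleftrightarrow> fst (w s) * fst (w s') < 0"
      by (metis of_int_less_0_iff of_int_mult)
    moreover have "real_of_int (fst (w s)) * real_of_int (snd (w s')) = real_of_int (snd (w s)) * real_of_int (fst (w s'))
        \<longleftrightarrow> det2 (w s) (w s') = 0"
      unfolding det2_def of_int_mult[symmetric] of_int_eq_iff by simp
    ultimately show "Re (K6_strand z i j n - K6_strand z k l n) * Im (K6_strand z i j (Suc n) - K6_strand z k l (Suc n)) \<noteq>
        Im (K6_strand z i j n - K6_strand z k l n) * Re (K6_strand z i j (Suc n) - K6_strand z k l (Suc n))"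
      using * neg by simp
  }
qed

lemma mem_disjoint_triples:
  "((p, q, r), (p', q', r')) \<in> set disjoint_triples \<longleftrightarrow>
     p < q \<and> q < r \<and> r < 6 \<and> p' < q' \<and> q' < r' \<and> r' < 6 \<and> {p, q, r} \<inter> {p', q', r'} = {}"
proof -
  have "(p, q, r) \<in> set triples \<longleftrightarrow> p < q \<and> q < r \<and> r < 6" for p q r
    by (force simp: triples_def)
  then show ?thesis
    by (simp add: disjoint_triples_def) blast
qed

text \<open>The value is twice the linking number. Once the first triangle is 013 or 245,
  disjointness determines the second.\<close>

lemma crossing_sum_K6:
  assumes ijk: "K6_level z i < K6_level z j" "K6_level z j < K6_level z k"
    and ijk': "K6_level z i' < K6_level z j'" "K6_level z j' < K6_level z k'"
    and disjoint: "{i, j, k} \<inter> {i', j', k'} = {}"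
  shows "crossing_sum (max (K6_level z i) (K6_level z i')) (min (K6_level z k) (K6_level z k'))
      (monotone_drawing.triangle_strand (K6_level z) (K6_strand z) i j k)
      (monotone_drawing.triangle_strand (K6_level z) (K6_strand z) i' j' k') =
    (if (i, j, k) = (0, 1, 3) \<or> (i, j, k) = (2, 4, 5) then 2 + 4 * real z else 0)"
proof -
  interpret monotone_drawing "3 * z + 6" "K6_level z" "\<lambda>i. cpx (vertex_pos (idx i))" "K6_strand z"
    by (rule monotone_drawing_K6)
  define t t' where "t = (idx i, idx j, idx k)" and "t' = (idx i', idx j', idx k')"
  define lo hi where "lo = max (K6_level z i) (K6_level z i')" and "hi = min (K6_level z k) (K6_level z k')"
  define G where "G = (\<lambda>n. step_sum t t' (phase z n) (phase z (Suc n)))"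
  have hi: "hi \<le> 3 * z + 6"
    using lv_le[of k] by (simp add: hi_def)
  have strand: "triangle_strand i j k \<sigma> n = cpx (triangle_pos (idx i, idx j, idx k) \<sigma> (phase z n))"
    if "K6_level z i < K6_level z j" "K6_level z j < K6_level z k" "n \<le> 3 * z + 6" for i j k \<sigma> n
  proof -
    have "K6_level z i < K6_level z k"
      using that by simp
    then show ?thesis
      using that phase_le_stage_iff[of "idx j" n z]
      by (simp add: triangle_strand_def triangle_pos_def K6_strand_less K6_level_def)
  qed
  have in_range: "lo \<le> n \<and> n < hi \<longleftrightarrow> stage (fst t) \<le> phase z n \<and> stage (fst t') \<le> phase z n \<and>
      phase z (Suc n) \<le> stage (snd (snd t)) \<and> phase z (Suc n) \<le> stage (snd (snd t'))"
    if "n < 3 * z + 6" for n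
    using that by (auto simp: t_def t'_def lo_def hi_def phase_le_stage_iff stage_le_phase_iff K6_level_def)
  have "crossing_sum lo hi (triangle_strand i j k) (triangle_strand i' j' k') =
      (\<Sum>n\<in>{lo..<hi}. \<Sum>\<sigma>\<in>UNIV. \<Sum>\<tau>\<in>UNIV. orient \<sigma> * orient \<tau> *
        slab_sign (triangle_strand i j k \<sigma> n - triangle_strand i' j' k' \<tau> n)
          (triangle_strand i j k \<sigma> (Suc n) - triangle_strand i' j' k' \<tau> (Suc n)))"
    unfolding crossing_sum_def
    by (simp only: sum.swap[of _ UNIV "{lo..<hi}"])
  also have "\<dots> = (\<Sum>n\<in>{lo..<hi}. real_of_int (G n))"
  proof (rule sum.cong[OF refl])
    fix n assume "n \<in> {lo..<hi}"
    then have n: "lo \<le> n \<and> n < hi" "n < 3 * z + 6" "Suc n \<le> 3 * z + 6" "n \<le> 3 * z + 6"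
      using hi by auto
    show "(\<Sum>\<sigma>\<in>UNIV. \<Sum>\<tau>\<in>UNIV. orient \<sigma> * orient \<tau> *
        slab_sign (triangle_strand i j k \<sigma> n - triangle_strand i' j' k' \<tau> n)
          (triangle_strand i j k \<sigma> (Suc n) - triangle_strand i' j' k' \<tau> (Suc n))) = real_of_int (G n)"
      using in_range[OF n(2)] n(1)
      unfolding strand[OF ijk n(3)] strand[OF ijk n(4)] strand[OF ijk' n(3)] strand[OF ijk' n(4)]
      by (simp add: cpx_diff slab_sign_cpx UNIV_bool orient_def G_def step_sum_def pair_sign_def t_def t'_def)
  qed
  \<comment> \<open>\<open>step_sum\<close> is 0 on slabs outside the common height range, so the
    sum extends to all slabs, as \<open>sum_phase\<close> requires.\<close>
  also have "\<dots> = (\<Sum>n<3 * z + 6. real_of_int (G n))"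
    by (rule sum.mono_neutral_left) (use hi in_range in \<open>auto simp: G_def step_sum_def\<close>)
  also have "\<dots> = real_of_int (\<Sum>n<3 * z + 6. G n)"
    by simp
  also have "(\<Sum>n<3 * z + 6. G n) = (if t = (0, 1, 3) \<or> t = (2, 4, 5) then 2 + 4 * int z else 0)"
  proof -
    have "(t, t') \<in> set disjoint_triples"
      using ijk ijk' disjoint by (auto simp: t_def t'_def mem_disjoint_triples K6_level_less_iff)
    then have "(let H = step_sum t t' in
      (H 0 1 + H 1 2 + H 2 3 + H 3 6 + H 6 7 + H 7 8, H 3 4 + H 4 5 + H 5 3) =
      (if t = (0, 1, 3) \<or> t = (2, 4, 5) then (2, 4) else (0, 0)))"
      using step_sums unfolding list_all_iff by fast
    then show ?thesis
      unfolding G_def sum_phase by (auto simp: Let_def split: if_splits)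
  qed
  also have "t = (0, 1, 3) \<or> t = (2, 4, 5) \<longleftrightarrow> (i, j, k) = (0, 1, 3) \<or> (i, j, k) = (2, 4, 5)"
    using idx_eq_iff[of _ 0] idx_eq_iff[of _ 1] idx_eq_iff[of _ 2] idx_eq_iff[of _ 3] idx_eq_iff[of _ 4] idx_eq_iff[of _ 5]
    by (simp add: t_def del: idx_eq_iff)
  finally show ?thesis
    by (simp add: lo_def hi_def)
qed

theorem proposition1p2:
  fixes z :: int
  assumes "0 \<le> z"
  shows "\<exists>f :: real^6 \<Rightarrow> real^3. PL_embedding_K6 f \<and>
    (\<forall>A\<in>K6_three_cycles. unknotted (f ` A)) \<and>
    (\<exists>C\<in>K6_three_cycles. \<exists>D\<in>K6_three_cycles. C \<inter> D = {} \<and>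
       (\<forall>A\<in>K6_three_cycles. \<forall>B\<in>K6_three_cycles.
          A \<inter> B = {} \<and> {A, B} \<noteq> {C, D} \<longrightarrow> has_abs_linking_number (f ` A) (f ` B) 0) \<and>
       has_abs_linking_number (f ` C) (f ` D) (2 * z + 1))"
proof -
  define m where "m = nat z"
  have z: "z = int m"
    using assms by (simp add: m_def)
  interpret monotone_drawing "3 * m + 6" "K6_level m" "\<lambda>i. cpx (vertex_pos (idx i))" "K6_strand m"
    by (rule monotone_drawing_K6)
  define C where "C = triangle 0 1 3"
  define D where "D = triangle 2 4 5"
  have lt: "K6_level m 0 < K6_level m 1" "K6_level m 1 < K6_level m 3" "K6_level m 2 < K6_level m 4" "K6_level m 4 < K6_level m 5"
    by (simp_all add: K6_level_less_iff)
  have CD: "C \<in> K6_three_cycles" "D \<in> K6_three_cycles"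
    unfolding C_def D_def by (intro triangle_mem lt)+
  have vertices: "\<exists>v. axis v 1 \<in> triangle i j k \<and> axis v 1 \<in> triangle i' j' k'"
    if common: "{i, j, k} \<inter> {i', j', k'} \<noteq> {}" for i j k i' j' k'
  proof -
    have vertex: "axis v 1 \<in> triangle i j k" if "v \<in> {i, j, k}" for v i j k
      using that by (elim insertE emptyE) (simp_all add: triangle_def axis_in_K6_edge)
    obtain v where "v \<in> {i, j, k}" "v \<in> {i', j', k'}"
      using common by blast
    then have "axis v 1 \<in> triangle i j k \<and> axis v 1 \<in> triangle i' j' k'"
      by (intro conjI vertex)
    then show ?thesis ..
  qed
  \<comment> \<open>The complement of \<open>{0, 1, 3}\<close> is \<open>{2, 4, 5}\<close>, and
    increasing levels fix the order. With \<open>partition'\<close>, a disjoint pair containing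
    \<open>C\<close> or \<open>D\<close> is the exceptional pair in one of its two orders.\<close>
  have partition: "triangle i' j' k' = D"
    if "(i, j, k) = (0, 1, 3)" "K6_level m i' < K6_level m j'" "K6_level m j' < K6_level m k'"
      "{i, j, k} \<inter> {i', j', k'} = {}" for i j k i' j' k'
  proof -
    have "i' \<in> {2, 4, 5}" "j' \<in> {2, 4, 5}" "k' \<in> {2, 4, 5}"
      using that(1,4) exhaust_6[of i'] exhaust_6[of j'] exhaust_6[of k'] by blast+
    then show ?thesis
      using that(2,3) unfolding D_def K6_level_less_iff by (elim insertE emptyE) simp_all
  qed
  have partition': "triangle i' j' k' = C"
    if "(i, j, k) = (2, 4, 5)" "K6_level m i' < K6_level m j'" "K6_level m j' < K6_level m k'"
      "{i, j, k} \<inter> {i', j', k'} = {}" for i j k i' j' k'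
  proof -
    have "i' \<in> {0, 1, 3}" "j' \<in> {0, 1, 3}" "k' \<in> {0, 1, 3}"
      using that(1,4) exhaust_6[of i'] exhaust_6[of j'] exhaust_6[of k'] by blast+
    then show ?thesis
      using that(2,3) unfolding C_def K6_level_less_iff by (elim insertE emptyE) simp_all
  qed
  have "C \<inter> D = {}"
    unfolding C_def D_def by (rule triangles_disjoint[OF lt]) simp
  moreover have "has_abs_linking_number (drawing ` A) (drawing ` B) 0"
    if A: "A \<in> K6_three_cycles" and B: "B \<in> K6_three_cycles" and AB: "A \<inter> B = {}" "{A, B} \<noteq> {C, D}" for A B
  proof -
    obtain i j k where ijk: "K6_level m i < K6_level m j" "K6_level m j < K6_level m k" "A = triangle i j k"
      using three_cycle_cases[OF A] .
    obtain i' j' k' where ijk': "K6_level m i' < K6_level m j'" "K6_level m j' < K6_level m k'" "B = triangle i' j' k'"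
      using three_cycle_cases[OF B] .
    have disj: "{i, j, k} \<inter> {i', j', k'} = {}"
      using vertices AB(1) unfolding ijk(3) ijk'(3) by blast
    have "(i, j, k) \<noteq> (0, 1, 3)" "(i, j, k) \<noteq> (2, 4, 5)"
      using AB(2) partition[OF _ ijk'(1,2) disj] partition'[OF _ ijk'(1,2) disj] ijk(3) ijk'(3)
      by (auto simp: C_def D_def insert_commute)
    then have "2 * real_of_int 0 = crossing_sum (max (K6_level m i) (K6_level m i')) (min (K6_level m k) (K6_level m k'))
        (triangle_strand i j k) (triangle_strand i' j' k')"
      using crossing_sum_K6[OF ijk(1,2) ijk'(1,2) disj] by simp
    from linking_number_triangles[OF ijk(1,2) ijk'(1,2) disj this] show ?thesis
      by (simp add: ijk(3) ijk'(3))
  qed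
  moreover have "has_abs_linking_number (drawing ` C) (drawing ` D) (2 * z + 1)"
  proof -
    have disj: "{0, 1, 3} \<inter> {2, 4, 5} = ({} :: 6 set)"
      by simp
    have "2 * real_of_int (2 * z + 1) = crossing_sum (max (K6_level m 0) (K6_level m 2)) (min (K6_level m 3) (K6_level m 5))
        (triangle_strand 0 1 3) (triangle_strand 2 4 5)"
      using crossing_sum_K6[OF lt disj] by (simp add: z)
    from linking_number_triangles[OF lt disj this] show ?thesis
      using assms by (simp add: C_def D_def)
  qed
  moreover have "unknotted (drawing ` A)" if A: "A \<in> K6_three_cycles" for A
    using three_cycle_cases[OF A] unknotted_triangle by metis
  ultimately show ?thesis
    using PL_embedding_drawing CD
    by (intro exI[of _ drawing] conjI ballI bexI[of _ C] bexI[of _ D] impI) (assumption | simp)+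
qed

end
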